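(* For every integer $n\ge 1$, the multi-virtual knot $K(n)$ has total crossing number $c_t(K(n))=2n+1$.
   Context: Fix the set of virtual crossing types $\mathcal{T}=\{\alpha_1,\alpha_2\}$. An oriented multi-virtual knot diagram is a generic immersion of an oriented circle in the plane (finitely many transverse double points) in which every double point is either a classical crossing (with over/under information) or a virtual crossing labelled by one type in $\mathcal{T}$. Two diagrams are equivalent if they are related by a finite sequence of planar isotopies, the classical Reidemeister moves $\Omega_1,\Omega_2,\Omega_3$ (involving only classical crossings) and the multi-virtual Reidemeister moves: $\Omega_1^v$ (add/remove a kink whose crossing is virtual of type $\alpha_i$); $\Omega_2^v$ (add/remove a bigon whose two crossings are both virtual of the same type $\alpha_i$); $\Omega_3^v$ (a strand having virtual crossings of type $\alpha_i$ with two other strands is slid across the virtual crossing of type $\alpha_j$ of those two strands, where $i=j$ is allowed); $\Omega_3^{cv}$ (a strand having virtual crossings of the same type $\alpha_i$ with two other strands is slid across the classical crossing of those two strands). An oriented multi-virtual knot is an equivalence class of such diagrams. The total crossing number $c_t(K)$ of a multi-virtual knot $K$ is the minimal number of all crossings (classical and virtual of every type, counted together) among all diagrams representing $K$. The knot $K(n)$: take the closure of the 2-braid $(\sigma_1)^{2n+1}$, where $\sigma_1$ is the standard generator (a positive crossing), oriented as a closed braid, and replace the first $2n$ classical crossings, in order along the braid, by virtual crossings of types $\alpha_1,\alpha_2,\alpha_1,\alpha_2,\dots,\alpha_1,\alpha_2$ alternately. The last crossing remains classical. The resulting diagram represents $K(n)$. *)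

theory Defs
  imports "HOL-Analysis.Analysis"
begin

section \<open>Multi-virtual knot diagrams\<close>

text \<open>
  The plane is the complex plane and the circle is \<open>\<real>/\<int>\<close>: a closed curve is a 1-periodic function
  on the reals, and two parameters denote the same point of the circle iff their difference is an
  integer. All curves and diffeomorphisms are of class \<open>C\<^sup>1\<close>.
\<close>

datatype vtype = Alpha1 | Alpha2

text \<open>
  The crossing data are attached to the parameters: each of the two passages of the curve through a
  crossing is marked as the over-passage, the under-passage, or a passage through a virtual crossing
  of the given type. Only the marks of parameters that run through a crossing carry information.
\<close>

datatype passage = Over | Under | Virt vtype

record mv_diagram =
  curve :: "real \<Rightarrow> complex"
  mark :: "real \<Rightarrow> passage"

definition double_points :: "mv_diagram \<Rightarrow> complex set" where
  "double_points D = {curve D s |s t. s - t \<notin> \<int> \<and> curve D s = curve D t}"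

fun compatible :: "passage \<Rightarrow> passage \<Rightarrow> bool" where
  "compatible Over Under = True"
| "compatible Under Over = True"
| "compatible (Virt a) (Virt b) = (a = b)"
| "compatible _ _ = False"

definition C1_immersion :: "(real \<Rightarrow> complex) \<Rightarrow> bool" where
  "C1_immersion f \<longleftrightarrow>
     (\<forall>t. f differentiable (at t) \<and> vector_derivative f (at t) \<noteq> 0) \<and>
     continuous_on UNIV (\<lambda>t. vector_derivative f (at t))"

text \<open>
  For complex numbers \<open>v\<close>, \<open>w\<close> the number \<open>Im (cnj v * w)\<close> is the determinant of \<open>v\<close> and \<open>w\<close> as
  vectors in the real plane, so the fourth clause below says that double points are transverse.
\<close>

definition is_diagram :: "mv_diagram \<Rightarrow> bool" where
  "is_diagram D \<longleftrightarrow>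
     (\<forall>t. curve D (t + 1) = curve D t \<and> mark D (t + 1) = mark D t) \<and>
     C1_immersion (curve D) \<and>
     finite (double_points D) \<and>
     (\<forall>s t. s - t \<notin> \<int> \<and> curve D s = curve D t \<longrightarrow>
        Im (cnj (vector_derivative (curve D) (at s)) * vector_derivative (curve D) (at t)) \<noteq> 0) \<and>
     (\<forall>r s t. curve D r = curve D s \<and> curve D s = curve D t \<longrightarrow>
        r - s \<in> \<int> \<or> s - t \<in> \<int> \<or> r - t \<in> \<int>) \<and>
     (\<forall>s t. s - t \<notin> \<int> \<and> curve D s = curve D t \<longrightarrow> compatible (mark D s) (mark D t))"


section \<open>Planar isotopy\<close>

definition ambient_isotopy :: "(real \<Rightarrow> complex \<Rightarrow> complex) \<Rightarrow> bool" where
  "ambient_isotopy H \<longleftrightarrow>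
     (\<forall>z. H 0 z = z) \<and>
     (\<forall>s\<in>{0..1}. bij (H s)) \<and>
     continuous_on ({0..1} \<times> UNIV) (\<lambda>(s, z). H s z) \<and>
     (\<exists>H' :: real \<Rightarrow> complex \<Rightarrow> complex \<Rightarrow>\<^sub>L complex.
        (\<forall>s\<in>{0..1}. \<forall>z. (H s has_derivative blinfun_apply (H' s z)) (at z) \<and>
                         bij (blinfun_apply (H' s z))) \<and>
        continuous_on ({0..1} \<times> UNIV) (\<lambda>(s, z). H' s z))"

text \<open>Lifts to the reals of the orientation preserving diffeomorphisms of the circle.\<close>

definition reparametrization :: "(real \<Rightarrow> real) \<Rightarrow> bool" where
  "reparametrization \<phi> \<longleftrightarrow>
     (\<forall>t. \<phi> (t + 1) = \<phi> t + 1) \<and>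
     (\<forall>t. \<phi> differentiable (at t) \<and> deriv \<phi> t > 0) \<and>
     continuous_on UNIV (deriv \<phi>)"

definition planar_isotopic :: "mv_diagram \<Rightarrow> mv_diagram \<Rightarrow> bool" where
  "planar_isotopic D D' \<longleftrightarrow>
     is_diagram D \<and> is_diagram D' \<and>
     (\<exists>H \<phi>. ambient_isotopy H \<and> reparametrization \<phi> \<and>
        (\<forall>t. curve D' t = H 1 (curve D (\<phi> t))) \<and>
        (\<forall>t. curve D' t \<in> double_points D' \<longrightarrow> mark D' t = mark D (\<phi> t)))"


section \<open>Reidemeister moves\<close>

text \<open>
  A tangle is a list of strands in the closed unit disc, each of them parametrized by \<open>{-1..1}\<close>. The
  two tangles of each move agree at the ends of the strands to first order. Since diagrams may be
  moved by planar isotopies, it suffices to have the moves in the standard position given here: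
  every disc in which a move can be carried out is brought to it by a planar isotopy (and a
  reparametrization). Mirror images and rotated pictures that are missing below are obtained from the
  given ones by rotations and by reversing the direction or the order of the strands.
\<close>

type_synonym tangle = "(real \<Rightarrow> complex) list"

definition R1_plain :: tangle where
  "R1_plain = [\<lambda>u. Complex u 0]"

definition R1_kink :: tangle where
  "R1_kink = [\<lambda>u. Complex (u * (1 - 2 * (1 - u\<^sup>2)\<^sup>2)) ((1 - u\<^sup>2)\<^sup>2)]"

definition R2_plain :: tangle where
  "R2_plain = [\<lambda>u. Complex u 0, \<lambda>u. Complex (4/5 * u) (3/5)]"

definition R2_bigon :: tangle where
  "R2_bigon = [\<lambda>u. Complex u 0, \<lambda>u. Complex (4/5 * u) (3/5 * (1 - 2 * (1 - u\<^sup>2)\<^sup>2))]"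

text \<open>
  Strands 0 and 1 are straight and meet at the origin; strand 2 passes above their crossing for
  \<open>e = 1\<close> and below it for \<open>e = -1\<close>.
\<close>

definition R3_tangle :: "real \<Rightarrow> tangle" where
  "R3_tangle e =
     [\<lambda>u. Complex (4/5 * u) (3/5 * u),
      \<lambda>u. Complex (4/5 * u) (- 3/5 * u),
      \<lambda>u. Complex u (e * (1 - u\<^sup>2)\<^sup>2)]"

text \<open>
  Strand \<open>i\<close> of the tangle is run through by the parameters \<open>c i + r i * u\<close>, \<open>u \<in> {-1..1}\<close>, of the
  diagram; the sign of \<open>r i\<close> is the direction in which the strand is oriented.
\<close>

definition on_strands :: "(nat \<Rightarrow> real) \<Rightarrow> (nat \<Rightarrow> real) \<Rightarrow> nat \<Rightarrow> real \<Rightarrow> bool" where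
  "on_strands c r k t \<longleftrightarrow> (\<exists>i<k. \<exists>u\<in>{-1..1}. t - (c i + r i * u) \<in> \<int>)"

text \<open>The diagram \<open>D'\<close> results from \<open>D\<close> by replacing the tangle \<open>T\<close> in the unit disc by \<open>T'\<close>.\<close>

definition replaces ::
    "tangle \<Rightarrow> tangle \<Rightarrow> (nat \<Rightarrow> real) \<Rightarrow> (nat \<Rightarrow> real) \<Rightarrow> mv_diagram \<Rightarrow> mv_diagram \<Rightarrow> bool" where
  "replaces T T' c r D D' \<longleftrightarrow>
     is_diagram D \<and> is_diagram D' \<and> length T = length T' \<and>
     (\<forall>i<length T. r i \<noteq> 0) \<and>
     (\<forall>i<length T. \<forall>j<length T. \<forall>u\<in>{-1..1}. \<forall>v\<in>{-1..1}.
        (c i + r i * u) - (c j + r j * v) \<in> \<int> \<longrightarrow> i = j \<and> u = v) \<and>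
     (\<forall>i<length T. \<forall>u\<in>{-1..1}.
        curve D (c i + r i * u) = (T ! i) u \<and> curve D' (c i + r i * u) = (T' ! i) u) \<and>
     (\<forall>t. \<not> on_strands c r (length T) t \<longrightarrow>
        curve D t \<notin> cball 0 1 \<and> curve D' t = curve D t \<and> mark D' t = mark D t)"

text \<open>
  \<open>L i u j v\<close> is the mark carried by strand \<open>i\<close> at its parameter \<open>u\<close> if it meets strand \<open>j\<close>
  at the parameter \<open>v\<close> of the latter.
\<close>

definition marked ::
    "tangle \<Rightarrow> (nat \<Rightarrow> real) \<Rightarrow> (nat \<Rightarrow> real) \<Rightarrow> (nat \<Rightarrow> real \<Rightarrow> nat \<Rightarrow> real \<Rightarrow> passage) \<Rightarrow>
      mv_diagram \<Rightarrow> bool" where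
  "marked T c r L D \<longleftrightarrow>
     (\<forall>i<length T. \<forall>j<length T. \<forall>u\<in>{-1..1}. \<forall>v\<in>{-1..1}.
        (i, u) \<noteq> (j, v) \<and> (T ! i) u = (T ! j) v \<longrightarrow> mark D (c i + r i * u) = L i u j v)"

inductive reidemeister_move :: "mv_diagram \<Rightarrow> mv_diagram \<Rightarrow> bool" where
  Omega1:
    "replaces R1_plain R1_kink c r D D' \<Longrightarrow> (p, q) \<in> {(Over, Under), (Under, Over)} \<Longrightarrow>
     marked R1_kink c r (\<lambda>i u j v. if u < v then p else q) D' \<Longrightarrow>
     reidemeister_move D D'"
| Omega1v:
    "replaces R1_plain R1_kink c r D D' \<Longrightarrow>
     marked R1_kink c r (\<lambda>i u j v. Virt a) D' \<Longrightarrow>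
     reidemeister_move D D'"
| Omega2:
    "replaces R2_plain R2_bigon c r D D' \<Longrightarrow> k \<in> {0, 1} \<Longrightarrow>
     marked R2_bigon c r (\<lambda>i u j v. if i = k then Over else Under) D' \<Longrightarrow>
     reidemeister_move D D'"
| Omega2v:
    "replaces R2_plain R2_bigon c r D D' \<Longrightarrow>
     marked R2_bigon c r (\<lambda>i u j v. Virt a) D' \<Longrightarrow>
     reidemeister_move D D'"
| Omega3:
    "replaces (R3_tangle 1) (R3_tangle (-1)) c r D D' \<Longrightarrow>
     inj_on (height :: nat \<Rightarrow> nat) {0, 1, 2} \<Longrightarrow>
     L = (\<lambda>i u j v. if height i > height j then Over else Under) \<Longrightarrow>
     marked (R3_tangle 1) c r L D \<Longrightarrow> marked (R3_tangle (-1)) c r L D' \<Longrightarrow>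
     reidemeister_move D D'"
| Omega3v:
    "replaces (R3_tangle 1) (R3_tangle (-1)) c r D D' \<Longrightarrow>
     L = (\<lambda>i u j v. if i = 2 \<or> j = 2 then Virt a else Virt b) \<Longrightarrow>
     marked (R3_tangle 1) c r L D \<Longrightarrow> marked (R3_tangle (-1)) c r L D' \<Longrightarrow>
     reidemeister_move D D'"
| Omega3cv:
    "replaces (R3_tangle 1) (R3_tangle (-1)) c r D D' \<Longrightarrow> k \<in> {0, 1} \<Longrightarrow>
     L = (\<lambda>i u j v. if i = 2 \<or> j = 2 then Virt a else if i = k then Over else Under) \<Longrightarrow>
     marked (R3_tangle 1) c r L D \<Longrightarrow> marked (R3_tangle (-1)) c r L D' \<Longrightarrow>
     reidemeister_move D D'"


section \<open>Multi-virtual knots and the total crossing number\<close>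

definition equivalent :: "mv_diagram \<Rightarrow> mv_diagram \<Rightarrow> bool" where
  "equivalent = equivclp (\<lambda>D D'. planar_isotopic D D' \<or> reidemeister_move D D')"

definition mv_knot :: "mv_diagram \<Rightarrow> mv_diagram set" where
  "mv_knot D = {D'. is_diagram D' \<and> equivalent D D'}"

definition total_crossing_number :: "mv_diagram set \<Rightarrow> nat" where
  "total_crossing_number K = (LEAST m. \<exists>D\<in>K. card (double_points D) = m)"


section \<open>The knots \<open>K(n)\<close>\<close>

datatype braid_letter = Sigma1 | VirtualLetter vtype

text \<open>
  The closure of a 2-braid word \<open>w\<close> of odd length \<open>m\<close>. The braid runs once counterclockwise around the
  origin, starting at angle 0; at angle \<open>\<theta>\<close> the two strands have the distances
  \<open>2 \<plusminus> cos (m * \<theta> / 2)\<close> from the origin. The \<open>k\<close>-th crossing (\<open>k < m\<close>) lies at the angle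
  \<open>(2 * k + 1) * pi / m\<close>, and the curve runs through it at the parameters
  \<open>(2 * k + 1) / (4 * m)\<close> and \<open>(2 * (k + m) + 1) / (4 * m)\<close>. At the parameter
  \<open>(2 * j + 1) / (4 * m)\<close> the distance from the origin increases iff \<open>j\<close> is odd, and a
  crossing is positive iff the distance increases along its over-passage.
\<close>

definition closed_2braid :: "braid_letter list \<Rightarrow> mv_diagram" where
  "closed_2braid w =
     (let m = length w in
      \<lparr> curve = (\<lambda>t. of_real (2 + cos (2 * pi * real m * t)) * cis (4 * pi * t)),
        mark = (\<lambda>t. let j = \<lfloor>2 * real m * t\<rfloor> in
                  case w ! nat (j mod int m) of
                    Sigma1 \<Rightarrow> (if odd j then Over else Under)
                  | VirtualLetter a \<Rightarrow> Virt a) \<rparr>)"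

definition K :: "nat \<Rightarrow> mv_diagram set" where
  "K n = mv_knot (closed_2braid
     (concat (replicate n [VirtualLetter Alpha1, VirtualLetter Alpha2]) @ [Sigma1]))"

end

theory Submission
  imports Defs
begin

text \<open>
  Attach to every classical crossing the pair of signed numbers of virtual crossings of the types
  \<open>\<alpha>\<^sub>1\<close>, \<open>\<alpha>\<^sub>2\<close> through which the curve runs on its way from the over-passage to the under-passage,
  the sign being that of the determinant of the velocities of the own and the other passage. No move
  changes the index of a crossing that takes part in it or stays outside: on each strand of a move the
  signs have the same sum before and after, and in \<open>\<Omega>\<^sub>3\<^sup>c\<^sup>v\<close> the two passages that switch sides
  have opposite signs. Classical crossings are created in pairs of equal index by \<open>\<Omega>\<^sub>2\<close>, and with
  index 0 by \<open>\<Omega>\<^sub>1\<close>. Hence for every nonzero index the parity of the number of classical crossings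
  with this index is an invariant. The only classical crossing of the braid diagram of \<open>K(n)\<close> has the
  index \<open>(-n, n)\<close>, so every diagram of \<open>K(n)\<close> has a classical crossing of this index. A virtual
  crossing changes one entry of an index by at most 1, so there are \<open>n\<close> virtual crossings of each type.
\<close>

section \<open>Crossings and their virtual index\<close>

text \<open>A classical crossing has a direction, from over to under, but a virtual crossing has
  none; its sign therefore sits on the passage, and its two passages carry opposite signs. So a
  virtual crossing enters an index only through the difference of the multiplicities of its two
  passages. Parity is enough, and it spares all bookkeeping of the signs of classical crossings: the
  pair created by \<open>Omega2\<close> disappears modulo 2. Index 0 is left out because
  \<open>Omega1\<close> creates a single crossing of that index. In the braid the sign of the
  determinant alternates from letter to letter, and so do the types; hence each type collects only
  one sign and nothing cancels, which gives the bound \<open>1 + n + n\<close>. Parameters enter an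
  index only through their circular order, recorded by floors of differences. Where a passage lies
  within its strand thus matters only for endpoints on the same strand.\<close>

abbreviation velocity :: "mv_diagram \<Rightarrow> real \<Rightarrow> complex" where
  "velocity D t \<equiv> vector_derivative (curve D) (at t)"

definition crossing_pairs :: "mv_diagram \<Rightarrow> (real \<times> real) set" where
  "crossing_pairs D =
     {(s, t). s \<in> {0..<1} \<and> t \<in> {0..<1} \<and> s \<noteq> t \<and> curve D s = curve D t}"

definition vsign :: "mv_diagram \<Rightarrow> vtype \<Rightarrow> real \<Rightarrow> real \<Rightarrow> real" where
  "vsign D a r r' =
     (if mark D r = Virt a then sgn (Im (cnj (velocity D r) * velocity D r')) else 0)"

text \<open>
  The summand counts with its sign how often the curve runs through the virtual passage \<open>r\<close>, modulo \<open>\<int>\<close>,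
  on the way from \<open>s\<close> to \<open>t\<close>. Since the signs of the two passages through a crossing cancel, the
  index depends on \<open>s\<close> and \<open>t\<close> only modulo \<open>\<int>\<close>.
\<close>

definition vindex :: "mv_diagram \<Rightarrow> vtype \<Rightarrow> real \<Rightarrow> real \<Rightarrow> real" where
  "vindex D a s t =
     (\<Sum>(r, r')\<in>crossing_pairs D. vsign D a r r' * of_int (\<lfloor>t - r\<rfloor> - \<lfloor>s - r\<rfloor>))"

definition indexed_crossings :: "mv_diagram \<Rightarrow> (vtype \<Rightarrow> real) \<Rightarrow> (real \<times> real) set" where
  "indexed_crossings D f =
     {(s, t) \<in> crossing_pairs D. mark D s = Over \<and> (\<forall>a. vindex D a s t = f a)}"

section \<open>Functions on the circle as periodic functions of a real parameter\<close>

lemma periodic_frac: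
  fixes f :: "real \<Rightarrow> 'a"
  assumes "\<And>t. f (t + 1) = f t"
  shows "f (frac t) = f t"
proof -
  have nat: "f (t + real n) = f t" for t n
  proof (induction n)
    case (Suc n)
    have "f (t + real (Suc n)) = f ((t + real n) + 1)" by (simp add: algebra_simps)
    then show ?case using Suc assms by simp
  qed simp
  have int: "f (t + of_int k) = f t" for t k
  proof (cases "k \<ge> 0")
    case True
    then show ?thesis using nat[of t "nat k"] by simp
  next
    case False
    then show ?thesis using nat[of "t + of_int k" "nat (- k)"] by simp
  qed
  show ?thesis using int[of t "- \<lfloor>t\<rfloor>"] by (simp add: frac_def)
qed

lemma Ints_diff_iff_frac_eq: "(s::real) - t \<in> \<int> \<longleftrightarrow> frac s = frac t"
proof
  assume "s - t \<in> \<int>"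
  then obtain k where k: "s - t = of_int k" by (auto elim: Ints_cases)
  then have "s = t + of_int k" by simp
  then show "frac s = frac t" by (simp add: frac_def)
next
  assume "frac s = frac t"
  then have "s - t = of_int (\<lfloor>s\<rfloor> - \<lfloor>t\<rfloor>)" by (simp add: frac_def)
  then show "s - t \<in> \<int>" by (metis Ints_of_int)
qed

lemma frac_in_unit: "frac (t::real) \<in> {0..<1}"
  by (simp add: frac_lt_1)

lemma frac_unit: "t \<in> {0..<1} \<Longrightarrow> frac (t::real) = t"
  by (simp add: frac_eq)

lemma Ints_diff_unit: "s \<in> {0..<1} \<Longrightarrow> t \<in> {0..<1} \<Longrightarrow> s - t \<in> \<int> \<longleftrightarrow> s = (t::real)"
  by (simp add: Ints_diff_iff_frac_eq frac_unit)

lemma has_vector_derivative_velocity: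
  assumes "is_diagram D"
  shows "(curve D has_vector_derivative velocity D t) (at t)"
  using assms unfolding is_diagram_def C1_immersion_def
  by (meson vector_derivative_works)

lemma continuous_curve:
  assumes "is_diagram D"
  shows "continuous_on UNIV (curve D)"
  using has_vector_derivative_velocity[OF assms]
  by (meson continuous_at_imp_continuous_on has_vector_derivative_continuous)

lemma velocity_unique:
  assumes "(curve D has_vector_derivative v) (at t)"
  shows "velocity D t = v"
  using assms by (rule vector_derivative_at)

lemma velocity_periodic:
  assumes "is_diagram D"
  shows "velocity D (t + 1) = velocity D t"
proof -
  have per: "curve D (x + 1) = curve D x" for x
    using assms by (simp add: is_diagram_def)
  have "((\<lambda>x. curve D (x + 1)) has_vector_derivative velocity D (t + 1)) (at t)"
    using vector_diff_chain_at[of "\<lambda>x. x + 1" 1 t "curve D" "velocity D (t + 1)"]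
      has_vector_derivative_velocity[OF assms, of "t + 1"]
    by (auto simp: o_def has_vector_derivative_add_const)
  then have "(curve D has_vector_derivative velocity D (t + 1)) (at t)"
    by (simp add: per)
  then show ?thesis by (rule velocity_unique[symmetric])
qed

lemma curve_frac: "is_diagram D \<Longrightarrow> curve D (frac t) = curve D t"
  by (rule periodic_frac) (simp add: is_diagram_def)

lemma mark_frac: "is_diagram D \<Longrightarrow> mark D (frac t) = mark D t"
  by (rule periodic_frac) (simp add: is_diagram_def)

lemma velocity_frac: "is_diagram D \<Longrightarrow> velocity D (frac t) = velocity D t"
  by (rule periodic_frac) (rule velocity_periodic)

lemma vsign_frac: "is_diagram D \<Longrightarrow> vsign D a (frac r) (frac r') = vsign D a r r'"
  by (simp add: vsign_def velocity_frac mark_frac)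

lemma frac_crossing_pair:
  assumes "is_diagram D"
  shows "(frac s, frac t) \<in> crossing_pairs D \<longleftrightarrow> s - t \<notin> \<int> \<and> curve D s = curve D t"
  using assms frac_in_unit[of s] frac_in_unit[of t]
  by (auto simp: crossing_pairs_def curve_frac Ints_diff_iff_frac_eq)

lemma crossing_pairs_iff:
  "(s, t) \<in> crossing_pairs D \<longleftrightarrow>
     s \<in> {0..<1} \<and> t \<in> {0..<1} \<and> s - t \<notin> \<int> \<and> curve D s = curve D t"
  using Ints_diff_unit[of s t] by (auto simp: crossing_pairs_def)

lemma crossing_pairs_swap: "(s, t) \<in> crossing_pairs D \<longleftrightarrow> (t, s) \<in> crossing_pairs D"
  by (auto simp: crossing_pairs_def)

lemma crossing_pair_compatible:
  assumes "is_diagram D" "(s, t) \<in> crossing_pairs D"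
  shows "compatible (mark D s) (mark D t)"
  using assms unfolding is_diagram_def crossing_pairs_iff by blast

lemma compatible_Virt: "compatible x y \<Longrightarrow> x = Virt a \<longleftrightarrow> y = Virt a"
  by (cases x; cases y) auto

lemma compatible_Over: "compatible Over y \<longleftrightarrow> y = Under"
  by (cases y) auto

lemma vsign_swap:
  assumes "is_diagram D" "(s, t) \<in> crossing_pairs D"
  shows "vsign D a t s = - vsign D a s t"
proof -
  have "Im (cnj (velocity D t) * velocity D s) = - Im (cnj (velocity D s) * velocity D t)"
    by simp
  moreover have "mark D s = Virt a \<longleftrightarrow> mark D t = Virt a"
    using crossing_pair_compatible[OF assms] by (rule compatible_Virt)
  ultimately show ?thesis by (simp only: vsign_def sgn_minus) simp
qed

lemma sum_crossing_pairs_swap: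
  "(\<Sum>(r, r')\<in>crossing_pairs D. g r r') = (\<Sum>(r, r')\<in>crossing_pairs D. g r' r)"
  by (rule sum.reindex_bij_witness[of _ prod.swap prod.swap]) (auto simp: crossing_pairs_swap)

lemma sum_vsign:
  assumes "is_diagram D"
  shows "(\<Sum>(r, r')\<in>crossing_pairs D. vsign D a r r') = 0"
proof -
  have "(\<Sum>(r, r')\<in>crossing_pairs D. vsign D a r r') = (\<Sum>(r, r')\<in>crossing_pairs D. vsign D a r' r)"
    by (rule sum_crossing_pairs_swap)
  also have "\<dots> = (\<Sum>(r, r')\<in>crossing_pairs D. - vsign D a r r')"
    by (rule sum.cong) (auto simp: vsign_swap[OF assms])
  finally show ?thesis by (simp add: sum_negf case_prod_unfold)
qed

lemma vindex_periodic1: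
  assumes "is_diagram D"
  shows "vindex D a (s + 1) t = vindex D a s t"
proof -
  have "\<lfloor>s + 1 - r\<rfloor> = \<lfloor>s - r\<rfloor> + 1" for r :: real
    by (simp add: floor_eq_iff algebra_simps) linarith
  then have "vindex D a (s + 1) t
    = (\<Sum>(r, r')\<in>crossing_pairs D. vsign D a r r' * of_int (\<lfloor>t - r\<rfloor> - \<lfloor>s - r\<rfloor>) - vsign D a r r')"
    unfolding vindex_def by (intro sum.cong) (auto simp: algebra_simps)
  then show ?thesis
    using sum_vsign[OF assms, of a] by (simp add: vindex_def sum_subtractf case_prod_unfold)
qed

lemma vindex_periodic2:
  assumes "is_diagram D"
  shows "vindex D a s (t + 1) = vindex D a s t"
proof -
  have anti: "vindex D a s t = - vindex D a t s" for s t
    unfolding vindex_def sum_negf[symmetric] by (rule sum.cong) (auto simp: algebra_simps)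
  show ?thesis using vindex_periodic1[OF assms] anti by metis
qed

lemma vindex_frac: "is_diagram D \<Longrightarrow> vindex D a (frac s) (frac t) = vindex D a s t"
  using periodic_frac[of "\<lambda>s. vindex D a s (frac t)" s] periodic_frac[of "vindex D a s" t]
  by (simp add: vindex_periodic1 vindex_periodic2)

text \<open>An index sums over representatives in \<open>{0..<1}\<close>. Replacing \<open>q\<close>
  by \<open>frac q\<close> shifts both floors by the same integer, so the summand may be evaluated
  at any other representative of the passage.\<close>

lemma floor_diff_frac:
  "\<lfloor>y - frac q\<rfloor> - \<lfloor>x - frac q\<rfloor> = \<lfloor>y - q\<rfloor> - \<lfloor>x - (q::real)\<rfloor>"
proof -
  have "z - frac q = z - q + of_int \<lfloor>q\<rfloor>" for z by (simp add: frac_def)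
  then show ?thesis by (simp only: floor_add_int[symmetric] add_diff_cancel_right)
qed

lemma double_points_eq:
  assumes "is_diagram D"
  shows "double_points D = (\<lambda>(s, t). curve D s) ` crossing_pairs D"
proof
  show "double_points D \<subseteq> (\<lambda>(s, t). curve D s) ` crossing_pairs D"
  proof
    fix z assume "z \<in> double_points D"
    then obtain s t where "z = curve D s" "s - t \<notin> \<int>" "curve D s = curve D t"
      by (auto simp: double_points_def)
    then show "z \<in> (\<lambda>(s, t). curve D s) ` crossing_pairs D"
      using frac_crossing_pair[OF assms, of s t] curve_frac[OF assms, of s] by force
  qed
  show "(\<lambda>(s, t). curve D s) ` crossing_pairs D \<subseteq> double_points D"
    unfolding double_points_def by (clarsimp simp: crossing_pairs_iff) metis
qed

text \<open>Without triple points, a double point has exactly two parameters on the circle. It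
  accounts for two ordered pairs, so counts of pairs are twice the counts of crossings.\<close>

lemma crossing_pairs_fibre:
  assumes "is_diagram D" "(s, t) \<in> crossing_pairs D"
  shows "{p \<in> crossing_pairs D. curve D (fst p) = curve D s} = {(s, t), (t, s)}"
proof (intro equalityI subsetI)
  fix p assume "p \<in> {p \<in> crossing_pairs D. curve D (fst p) = curve D s}"
  then obtain x y where p: "p = (x, y)" and xy: "(x, y) \<in> crossing_pairs D" "curve D x = curve D s"
    by (cases p) auto
  have triple: "a - b \<in> \<int> \<or> b - c \<in> \<int> \<or> a - c \<in> \<int>"
    if "curve D a = curve D b" "curve D b = curve D c" for a b c
    using assms(1) that unfolding is_diagram_def by blast
  have mem: "s \<in> {0..<1}" "t \<in> {0..<1}" "x \<in> {0..<1}" "y \<in> {0..<1}" "s \<noteq> t" "x \<noteq> y"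
    "curve D s = curve D t" "curve D x = curve D y"
    using assms(2) xy by (auto simp: crossing_pairs_def)
  have "x = s \<or> x = t" "y = s \<or> y = t"
    using triple[of x s t] triple[of y s t] mem xy(2) by (auto simp: Ints_diff_unit)
  then show "p \<in> {(s, t), (t, s)}" using p mem by auto
qed (use assms(2) crossing_pairs_swap in \<open>auto simp: crossing_pairs_def\<close>)

lemma
  assumes "is_diagram D"
  shows finite_crossing_pairs: "finite (crossing_pairs D)"
    and card_crossing_pairs: "card (crossing_pairs D) = 2 * card (double_points D)"
proof -
  let ?F = "\<lambda>z. {p \<in> crossing_pairs D. curve D (fst p) = z}"
  have fin: "finite (double_points D)" using assms by (simp add: is_diagram_def)
  have F: "finite (?F z) \<and> card (?F z) = 2" if "z \<in> double_points D" for z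
  proof -
    obtain s t where "(s, t) \<in> crossing_pairs D" "z = curve D s"
      using \<open>z \<in> double_points D\<close> unfolding double_points_eq[OF assms] by auto
    then have "?F z = {(s, t), (t, s)}" "s \<noteq> t"
      using crossing_pairs_fibre[OF assms] by (auto simp: crossing_pairs_def)
    then show ?thesis by simp
  qed
  have U: "crossing_pairs D = (\<Union>z\<in>double_points D. ?F z)"
    using double_points_eq[OF assms] by force
  show "finite (crossing_pairs D)"
    by (subst U, rule finite_UN_I[OF fin]) (use F in blast)
  have "card (crossing_pairs D) = (\<Sum>z\<in>double_points D. card (?F z))"
    by (subst U, rule card_UN_disjoint) (use fin F in auto)
  then show "card (crossing_pairs D) = 2 * card (double_points D)"
    using F by simp
qed

section \<open>How far one virtual crossing can change an index\<close>

lemma floor_diff_bound: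
  fixes s t :: real
  assumes "s \<in> {0..<1}" "t \<in> {0..<1}" "r \<in> {0..<1}" "r' \<in> {0..<1}"
  shows "\<bar>(\<lfloor>t - r\<rfloor> - \<lfloor>s - r\<rfloor>) - (\<lfloor>t - r'\<rfloor> - \<lfloor>s - r'\<rfloor>)\<bar> \<le> 1"
proof -
  \<comment> \<open>With truth values read as 0 and 1, a multiplicity is thus
    \<open>(r \<le> t) - (r \<le> s)\<close>. For given \<open>s\<close> and \<open>t\<close> all
    multiplicities lie in {0, 1}, or all lie in {-1, 0}.\<close>
  have "\<lfloor>x - y\<rfloor> = (if y \<le> x then 0 else - 1)" if "x \<in> {0..<1}" "y \<in> {0..<1}" for x y :: real
    using that by (auto simp: floor_eq_iff)
  then show ?thesis using assms by simp
qed

text \<open>Adding the sum to its swapped form combines the two passages of a crossing, which have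
  opposite signs, into the difference of their multiplicities. The factor 2 is balanced on the
  right, where every virtual crossing occurs as two ordered pairs.\<close>

lemma vindex_bound:
  assumes D: "is_diagram D" and st: "s \<in> {0..<1}" "t \<in> {0..<1}"
  shows "2 * \<bar>vindex D a s t\<bar> \<le> card {(r, r') \<in> crossing_pairs D. mark D r = Virt a}"
proof -
  let ?g = "\<lambda>r. of_int (\<lfloor>t - r\<rfloor> - \<lfloor>s - r\<rfloor>) :: real"
  have "vindex D a s t = (\<Sum>(r, r')\<in>crossing_pairs D. vsign D a r' r * ?g r')"
    unfolding vindex_def by (rule sum_crossing_pairs_swap)
  also have "\<dots> = (\<Sum>(r, r')\<in>crossing_pairs D. - vsign D a r r' * ?g r')"
    by (rule sum.cong) (auto simp: vsign_swap[OF D])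
  finally have "2 * vindex D a s t
      = (\<Sum>(r, r')\<in>crossing_pairs D. vsign D a r r' * ?g r) + (\<Sum>(r, r')\<in>crossing_pairs D. - vsign D a r r' * ?g r')"
    by (simp add: vindex_def)
  also have "\<dots> = (\<Sum>(r, r')\<in>crossing_pairs D. vsign D a r r' * (?g r - ?g r'))"
    by (simp add: sum.distrib[symmetric] case_prod_unfold algebra_simps)
  finally have "\<bar>2 * vindex D a s t\<bar> \<le> (\<Sum>p\<in>crossing_pairs D. \<bar>(\<lambda>(r, r'). vsign D a r r' * (?g r - ?g r')) p\<bar>)"
    by (simp only: sum_abs)
  also have "\<dots> \<le> (\<Sum>p\<in>crossing_pairs D. if mark D (fst p) = Virt a then 1 else 0)"
  proof (rule sum_mono)
    fix p assume "p \<in> crossing_pairs D"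
    moreover obtain r r' where p: "p = (r, r')" by (cases p)
    ultimately have "r \<in> {0..<1}" "r' \<in> {0..<1}" by (auto simp: crossing_pairs_def)
    then have "\<bar>?g r - ?g r'\<bar> \<le> 1" using floor_diff_bound[OF st, of r r'] by linarith
    moreover have "\<bar>vsign D a r r'\<bar> \<le> (if mark D r = Virt a then 1 else 0)"
      by (auto simp: vsign_def sgn_if)
    ultimately have "\<bar>vsign D a r r'\<bar> * \<bar>?g r - ?g r'\<bar> \<le> (if mark D r = Virt a then 1 else 0) * 1"
      by (intro mult_mono) auto
    then show "\<bar>(\<lambda>(r, r'). vsign D a r r' * (?g r - ?g r')) p\<bar> \<le> (if mark D (fst p) = Virt a then 1 else 0)"
      by (simp add: p abs_mult del: of_int_diff)
  qed
  also have "\<dots> = card {p \<in> crossing_pairs D. mark D (fst p) = Virt a}"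
    using finite_crossing_pairs[OF D] by (simp add: sum.If_cases Int_def)
  also have "{p \<in> crossing_pairs D. mark D (fst p) = Virt a} = {(r, r') \<in> crossing_pairs D. mark D r = Virt a}"
    by auto
  finally show ?thesis by simp
qed

lemma crossing_number_bound:
  assumes D: "is_diagram D" and ne: "indexed_crossings D f \<noteq> {}"
  shows "1 + \<bar>f Alpha1\<bar> + \<bar>f Alpha2\<bar> \<le> card (double_points D)"
proof -
  obtain s t where st: "(s, t) \<in> crossing_pairs D" "mark D s = Over" and f: "\<And>a. vindex D a s t = f a"
    using ne by (auto simp: indexed_crossings_def)
  \<comment> \<open>This keeps \<open>(t, s)\<close>, which starts at the under-passage, out of the
    sets \<open>?V\<close> below, so that the three sets of pairs counted there are
    disjoint.\<close>
  have "mark D t = Under" using crossing_pair_compatible[OF D st(1)] st(2) compatible_Over by simp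
  have mem: "s \<in> {0..<1}" "t \<in> {0..<1}" "s \<noteq> t" using st by (auto simp: crossing_pairs_def)
  let ?V = "\<lambda>a. {(r, r') \<in> crossing_pairs D. mark D r = Virt a}"
  have fin: "finite (?V a)" for a
    by (rule finite_subset[OF _ finite_crossing_pairs[OF D]]) auto
  have "card ({(s, t), (t, s)} \<union> (?V Alpha1 \<union> ?V Alpha2)) = 2 + (card (?V Alpha1) + card (?V Alpha2))"
    using fin st \<open>mark D t = Under\<close> mem by (subst card_Un_disjoint; (subst card_Un_disjoint)?) auto
  moreover have "card ({(s, t), (t, s)} \<union> (?V Alpha1 \<union> ?V Alpha2)) \<le> card (crossing_pairs D)"
    by (rule card_mono[OF finite_crossing_pairs[OF D]]) (use st crossing_pairs_swap in auto)
  ultimately have "2 + (card (?V Alpha1) + card (?V Alpha2)) \<le> 2 * card (double_points D)"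
    by (simp add: card_crossing_pairs[OF D])
  then have "2 + (real (card (?V Alpha1)) + real (card (?V Alpha2))) \<le> 2 * real (card (double_points D))"
    by linarith
  then show ?thesis
    using vindex_bound[OF D mem(1,2), of Alpha1] vindex_bound[OF D mem(1,2), of Alpha2] f by simp
qed

section \<open>Planar isotopies\<close>

text \<open>\<open>Im (cnj (A 1) * A \<i>)\<close> is the determinant of \<open>A\<close> in the
  real basis \<open>1\<close>, \<open>\<i>\<close>, so this is its multiplicativity.\<close>

lemma det_linear:
  fixes A :: "complex \<Rightarrow> complex"
  assumes "linear A"
  shows "Im (cnj (A v) * A w) = Im (cnj (A 1) * A \<i>) * Im (cnj v * w)"
proof -
  have "A x = Re x *\<^sub>R A 1 + Im x *\<^sub>R A \<i>" for x
  proof -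
    have "x = Re x *\<^sub>R 1 + Im x *\<^sub>R \<i>" by (simp add: complex_eq_iff)
    then have "A x = A (Re x *\<^sub>R 1 + Im x *\<^sub>R \<i>)" by simp
    also have "\<dots> = Re x *\<^sub>R A 1 + Im x *\<^sub>R A \<i>"
      using assms by (simp only: linear_add linear_scale)
    finally show ?thesis .
  qed
  from this[of v] this[of w] show ?thesis
    by (simp add: algebra_simps)
qed

lemma det_bij:
  assumes "linear A" "bij A"
  shows "Im (cnj (A 1) * A \<i>) \<noteq> 0"
proof
  assume 0: "Im (cnj (A 1) * A \<i>) = 0"
  obtain v w where "A v = 1" "A w = \<i>" using assms(2) by (metis bij_pointE)
  then show False using det_linear[OF assms(1), of v w] 0 by simp
qed

text \<open>At a fixed point the determinant of the derivative depends continuously on time, never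
  vanishes and starts at 1. Positivity at time 1 rules out reflections, which would reverse the
  signs in the index.\<close>

lemma ambient_isotopy_det_pos:
  assumes H: "ambient_isotopy H"
  obtains A where "(H 1 has_derivative A) (at z)" "Im (cnj (A 1) * A \<i>) > 0"
proof -
  obtain H' :: "real \<Rightarrow> complex \<Rightarrow> complex \<Rightarrow>\<^sub>L complex"
    where H': "\<And>s z. s \<in> {0..1} \<Longrightarrow> (H s has_derivative blinfun_apply (H' s z)) (at z)"
      and bij: "\<And>s z. s \<in> {0..1} \<Longrightarrow> bij (blinfun_apply (H' s z))"
      and cont: "continuous_on ({0..1} \<times> UNIV) (\<lambda>(s, z). H' s z)"
    using H unfolding ambient_isotopy_def by blast
  define d where "d s = Im (cnj (H' s z 1) * H' s z \<i>)" for s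
  have contz: "continuous_on {0..1} (\<lambda>s. H' s z)"
    using continuous_on_compose2[OF cont, of "{0..1}" "\<lambda>s. (s, z)"]
    by (simp add: continuous_on_Pair image_subset_iff)
  have "continuous_on {0..1} d"
    unfolding d_def by (intro continuous_intros contz)
  moreover have "d s \<noteq> 0" if "s \<in> {0..1}" for s
    unfolding d_def using det_bij bij[OF that] bounded_linear.linear[OF blinfun.bounded_linear_right] by metis
  moreover have "d 0 = 1"
  proof -
    have "H 0 = (\<lambda>z. z)" using H by (auto simp: ambient_isotopy_def)
    then have "(H 0 has_derivative (\<lambda>z. z)) (at z)" by simp
    then have "blinfun_apply (H' 0 z) = (\<lambda>z. z)"
      using H'[of 0 z] by (intro has_derivative_unique) auto
    then show ?thesis by (simp add: d_def)
  qed
  ultimately have "d 1 > 0"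
    using IVT2'[of d 1 0 0] by fastforce
  then show ?thesis using that[OF H'[of 1 z]] by (simp add: d_def)
qed

section \<open>Reparametrizations of the circle\<close>

lemma reparametrization_shift:
  assumes "reparametrization \<phi>"
  shows "\<phi> (t + of_int k) = \<phi> t + of_int k"
proof -
  have per: "\<phi> (frac u) - frac u = \<phi> u - u" for u
    using periodic_frac[of "\<lambda>u. \<phi> u - u" u] assms by (simp add: reparametrization_def)
  have "frac (t + of_int k) = frac t" by (simp add: frac_def)
  then show ?thesis using per[of t] per[of "t + of_int k"] by simp
qed

lemma strict_mono_reparametrization:
  assumes "reparametrization \<phi>"
  shows "strict_mono \<phi>"
proof (rule strict_monoI)
  fix x y :: real assume "x < y"
  then show "\<phi> x < \<phi> y"
  proof (rule DERIV_pos_imp_increasing)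
    fix u
    have "\<phi> differentiable (at u)" "deriv \<phi> u > 0"
      using assms by (auto simp: reparametrization_def)
    then show "\<exists>l. DERIV \<phi> u :> l \<and> l > 0"
      using DERIV_deriv_iff_real_differentiable by blast
  qed
qed

text \<open>An increasing map that commutes with integer translations preserves the circular order,
  and with it the multiplicity of a passage in an index.\<close>

lemma floor_reparametrization:
  assumes "reparametrization \<phi>"
  shows "\<lfloor>\<phi> t - \<phi> r\<rfloor> = \<lfloor>t - r\<rfloor>"
proof -
  let ?k = "\<lfloor>t - r\<rfloor>"
  have "r + of_int ?k \<le> t" "t < r + of_int (?k + 1)" by linarith+
  then have "\<phi> (r + of_int ?k) \<le> \<phi> t" "\<phi> t < \<phi> (r + of_int (?k + 1))"
    using strict_mono_reparametrization[OF assms] by (auto simp: strict_mono_less_eq strict_mono_less)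
  then show ?thesis
    unfolding reparametrization_shift[OF assms] by (simp add: floor_eq_iff)
qed

lemma Ints_reparametrization:
  assumes "reparametrization \<phi>"
  shows "\<phi> s - \<phi> t \<in> \<int> \<longleftrightarrow> s - t \<in> \<int>"
proof
  assume "\<phi> s - \<phi> t \<in> \<int>"
  then obtain k where "\<phi> s - \<phi> t = of_int k" by (auto elim: Ints_cases)
  then have "\<phi> s = \<phi> (t + of_int k)" by (simp add: reparametrization_shift[OF assms])
  then have "s = t + of_int k"
    using strict_mono_reparametrization[OF assms] by (simp add: strict_mono_eq)
  then show "s - t \<in> \<int>" by simp
next
  assume "s - t \<in> \<int>"
  then obtain k where "s - t = of_int k" by (auto elim: Ints_cases)
  then have "s = t + of_int k" by simp
  then show "\<phi> s - \<phi> t \<in> \<int>" by (simp add: reparametrization_shift[OF assms])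
qed

lemma surj_reparametrization:
  assumes "reparametrization \<phi>"
  obtains x where "\<phi> x = y"
proof -
  \<comment> \<open>Chosen so that \<open>y\<close> lies between \<open>\<phi> 0 + ?k\<close> and
    \<open>\<phi> 0 + ?k + 1\<close>, the values of \<open>\<phi>\<close> at \<open>?k\<close> and
    \<open>?k + 1\<close>.\<close>
  let ?k = "\<lfloor>y - \<phi> 0\<rfloor>"
  have "continuous_on {of_int ?k..of_int ?k + 1} \<phi>"
    using assms unfolding reparametrization_def
    by (meson continuous_at_imp_continuous_on differentiable_imp_continuous_within)
  moreover have "\<phi> (of_int ?k) = \<phi> 0 + of_int ?k" "\<phi> (of_int ?k + 1) = \<phi> 0 + of_int ?k + 1"
    using reparametrization_shift[OF assms, of 0 ?k] reparametrization_shift[OF assms, of 0 "?k + 1"]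
    by simp_all
  ultimately have "\<exists>x\<ge>of_int ?k. x \<le> of_int ?k + 1 \<and> \<phi> x = y"
    by (intro IVT') (linarith, linarith, simp, simp)
  then show ?thesis using that by blast
qed

lemma planar_isotopic_pullback:
  assumes D: "is_diagram D" and D': "is_diagram D'"
    and H: "ambient_isotopy H" and \<phi>: "reparametrization \<phi>"
    and curve: "\<And>t. curve D' t = H 1 (curve D (\<phi> t))"
    and mark: "\<And>t. curve D' t \<in> double_points D' \<Longrightarrow> mark D' t = mark D (\<phi> t)"
  shows "bij_betw (\<lambda>(s, t). (frac (\<phi> s), frac (\<phi> t))) (crossing_pairs D') (crossing_pairs D)"
      (is "bij_betw ?m _ _")
    and "(s, t) \<in> crossing_pairs D' \<Longrightarrow> vsign D' a s t = vsign D a (\<phi> s) (\<phi> t)"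
    and "(s, t) \<in> crossing_pairs D' \<Longrightarrow> mark D' s = mark D (\<phi> s)"
proof -
  have "inj (H 1)" using H by (auto simp: ambient_isotopy_def bij_def)
  then have eq: "curve D' s = curve D' t \<longleftrightarrow> curve D (\<phi> s) = curve D (\<phi> t)" for s t
    by (simp add: curve inj_eq)
  show "bij_betw ?m (crossing_pairs D') (crossing_pairs D)"
    unfolding bij_betw_def
  proof
    show "inj_on ?m (crossing_pairs D')"
      by (rule inj_onI)
        (auto simp: crossing_pairs_def Ints_diff_iff_frac_eq[symmetric] Ints_reparametrization[OF \<phi>]
          Ints_diff_unit)
    show "?m ` crossing_pairs D' = crossing_pairs D"
    proof (intro equalityI subsetI)
      fix p assume "p \<in> ?m ` crossing_pairs D'"
      then show "p \<in> crossing_pairs D"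
        by (auto simp: frac_crossing_pair[OF D] Ints_reparametrization[OF \<phi>] eq
            crossing_pairs_iff[of _ _ D'])
    next
      fix p assume p: "p \<in> crossing_pairs D"
      obtain s t where st: "p = (s, t)" by (cases p)
      obtain x where x: "\<phi> x = s" by (rule surj_reparametrization[OF \<phi>])
      obtain y where y: "\<phi> y = t" by (rule surj_reparametrization[OF \<phi>])
      have fr: "frac (\<phi> (frac u)) = frac (\<phi> u)" for u
        using reparametrization_shift[OF \<phi>, of "frac u" "\<lfloor>u\<rfloor>"] by (simp add: frac_def)
      have "(frac x, frac y) \<in> crossing_pairs D'"
        using p Ints_reparametrization[OF \<phi>, of x y]
        by (auto simp: frac_crossing_pair[OF D'] crossing_pairs_iff[of _ _ D] eq x y st)
      moreover have "?m (frac x, frac y) = p"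
        using p by (simp add: fr x y st crossing_pairs_def frac_unit)
      ultimately show "p \<in> ?m ` crossing_pairs D'" by (metis imageI)
    qed
  qed
  show mk: "(s, t) \<in> crossing_pairs D' \<Longrightarrow> mark D' s = mark D (\<phi> s)" for s t
    by (rule mark) (clarsimp simp: double_points_def crossing_pairs_iff, metis)
  show "vsign D' a s t = vsign D a (\<phi> s) (\<phi> t)" if st: "(s, t) \<in> crossing_pairs D'"
  proof -
    have same: "curve D (\<phi> s) = curve D (\<phi> t)" using st eq by (simp add: crossing_pairs_def)
    obtain A where A: "(H 1 has_derivative A) (at (curve D (\<phi> s)))" and pos: "Im (cnj (A 1) * A \<i>) > 0"
      by (rule ambient_isotopy_det_pos[OF H])
    have lin: "linear A" using A by (rule has_derivative_linear)
    \<comment> \<open>Both passages lie over the same point of the plane, so one derivative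
      \<open>A\<close> of \<open>H 1\<close> serves for both velocities; the positive factor
      \<open>deriv \<phi> u\<close> drops out of the sign.\<close>
    have vel: "velocity D' u = deriv \<phi> u *\<^sub>R A (velocity D (\<phi> u))" if "curve D (\<phi> u) = curve D (\<phi> s)" for u
    proof -
      have "(\<phi> has_vector_derivative deriv \<phi> u) (at u)"
        using \<phi> unfolding reparametrization_def
        by (metis DERIV_deriv_iff_real_differentiable has_real_derivative_iff_has_vector_derivative)
      then have "((curve D \<circ> \<phi>) has_vector_derivative deriv \<phi> u *\<^sub>R velocity D (\<phi> u)) (at u)"
        using has_vector_derivative_velocity[OF D] by (rule vector_diff_chain_at)
      moreover have "(H 1 has_derivative A) (at ((curve D \<circ> \<phi>) u))" using A that by simp
      ultimately have "((H 1 \<circ> (curve D \<circ> \<phi>)) has_derivative A \<circ> (\<lambda>h. h *\<^sub>R (deriv \<phi> u *\<^sub>R velocity D (\<phi> u)))) (at u)"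
        unfolding has_vector_derivative_def by (rule diff_chain_at)
      moreover have "H 1 \<circ> (curve D \<circ> \<phi>) = curve D'" by (auto simp: curve)
      ultimately have "(curve D' has_vector_derivative deriv \<phi> u *\<^sub>R A (velocity D (\<phi> u))) (at u)"
        by (simp add: has_vector_derivative_def o_def linear_scale[OF lin])
      then show ?thesis by (rule velocity_unique)
    qed
    have "Im (cnj (velocity D' s) * velocity D' t)
        = deriv \<phi> s * deriv \<phi> t * Im (cnj (A (velocity D (\<phi> s))) * A (velocity D (\<phi> t)))"
      unfolding vel[OF refl] vel[OF same[symmetric]] by (simp add: algebra_simps)
    also have "\<dots> = deriv \<phi> s * deriv \<phi> t * Im (cnj (A 1) * A \<i>)
        * Im (cnj (velocity D (\<phi> s)) * velocity D (\<phi> t))"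
      by (simp only: det_linear[OF lin, of "velocity D (\<phi> s)"] mult.assoc)
    finally have "sgn (Im (cnj (velocity D' s) * velocity D' t)) = sgn (Im (cnj (velocity D (\<phi> s)) * velocity D (\<phi> t)))"
      using pos \<phi> by (simp only: sgn_mult reparametrization_def sgn_pos mult_1)
    then show ?thesis using mk[OF st] by (simp add: vsign_def)
  qed
qed

lemma card_indexed_crossings_isotopic:
  assumes "planar_isotopic D D'"
  shows "card (indexed_crossings D' f) = card (indexed_crossings D f)"
proof -
  from assms obtain H \<phi> where D: "is_diagram D" and D': "is_diagram D'"
    and H: "ambient_isotopy H" and \<phi>: "reparametrization \<phi>"
    and curve: "\<And>t. curve D' t = H 1 (curve D (\<phi> t))"
    and mark: "\<And>t. curve D' t \<in> double_points D' \<Longrightarrow> mark D' t = mark D (\<phi> t)"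
    by (auto simp: planar_isotopic_def)
  note pullback = planar_isotopic_pullback[OF D D' H \<phi> curve mark]
  let ?m = "\<lambda>(s, t). (frac (\<phi> s), frac (\<phi> t))"
  have ind: "vindex D' a s t = vindex D a (\<phi> s) (\<phi> t)" for a s t
    unfolding vindex_def
  proof (rule trans[OF sym sum.reindex_bij_betw[OF pullback(1)]])
    show "(\<Sum>p\<in>crossing_pairs D'. case ?m p of (r, r') \<Rightarrow> vsign D a r r' * real_of_int (\<lfloor>\<phi> t - r\<rfloor> - \<lfloor>\<phi> s - r\<rfloor>))
      = (\<Sum>(r, r')\<in>crossing_pairs D'. vsign D' a r r' * of_int (\<lfloor>t - r\<rfloor> - \<lfloor>s - r\<rfloor>))"
      by (rule sum.cong) (auto simp only: case_prod_conv floor_diff_frac floor_reparametrization[OF \<phi>]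
          pullback(2) vsign_frac[OF D])
  qed
  have "bij_betw ?m (indexed_crossings D' f) (indexed_crossings D f)"
  proof -
    have mem: "?m p \<in> indexed_crossings D f \<longleftrightarrow> p \<in> indexed_crossings D' f" if "p \<in> crossing_pairs D'" for p
      using that bij_betwE[OF pullback(1)] pullback(3)
      by (cases p) (fastforce simp: indexed_crossings_def ind vindex_frac[OF D] mark_frac[OF D])
    have "?m ` indexed_crossings D' f = indexed_crossings D f"
    proof (intro equalityI subsetI)
      fix q assume "q \<in> indexed_crossings D f"
      moreover from this have "q \<in> ?m ` crossing_pairs D'"
        using pullback(1) by (auto simp: bij_betw_def indexed_crossings_def)
      ultimately show "q \<in> ?m ` indexed_crossings D' f" using mem by blast
    qed (use mem in \<open>auto simp: indexed_crossings_def\<close>)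
    then show ?thesis
      using bij_betw_subset[OF pullback(1), of "indexed_crossings D' f"]
      by (auto simp: indexed_crossings_def)
  qed
  then show ?thesis by (rule bij_betw_same_card)
qed

section \<open>Tangles in a diagram\<close>

definition param :: "(nat \<Rightarrow> real) \<Rightarrow> (nat \<Rightarrow> real) \<Rightarrow> nat \<times> real \<Rightarrow> real" where
  "param c r = (\<lambda>(i, u). c i + r i * u)"

lemma param_simp [simp]: "param c r (i, u) = c i + r i * u"
  by (simp add: param_def)

definition tangle_crossings :: "tangle \<Rightarrow> ((nat \<times> real) \<times> (nat \<times> real)) set" where
  "tangle_crossings T =
     {((i, u), (j, v)) |i u j v. i < length T \<and> j < length T \<and> u \<in> {-1..1} \<and> v \<in> {-1..1} \<and>
        (i, u) \<noteq> (j, v) \<and> (T ! i) u = (T ! j) v}"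

definition in_disc :: "tangle \<Rightarrow> bool" where
  "in_disc T \<longleftrightarrow> (\<forall>i<length T. \<forall>u\<in>{-1..1}. (T ! i) u \<in> cball 0 1)"

definition outer_pairs :: "mv_diagram \<Rightarrow> (real \<times> real) set" where
  "outer_pairs D = {(s, t) \<in> crossing_pairs D. curve D s \<notin> cball 0 1}"

definition outer_index :: "mv_diagram \<Rightarrow> vtype \<Rightarrow> real \<Rightarrow> real \<Rightarrow> real" where
  "outer_index D a s t =
     (\<Sum>(q, q')\<in>outer_pairs D. vsign D a q q' * of_int (\<lfloor>t - q\<rfloor> - \<lfloor>s - q\<rfloor>))"

definition inner_index ::
    "tangle \<Rightarrow> (nat \<Rightarrow> real) \<Rightarrow> (nat \<Rightarrow> real) \<Rightarrow> mv_diagram \<Rightarrow> vtype \<Rightarrow> real \<Rightarrow> real \<Rightarrow> real" where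
  "inner_index T c r D a s t =
     (\<Sum>(x, y)\<in>tangle_crossings T. vsign D a (param c r x) (param c r y) *
        of_int (\<lfloor>t - param c r x\<rfloor> - \<lfloor>s - param c r x\<rfloor>))"

text \<open>Only the crossing is taken from the tangle; its index is that of the whole diagram,
  including the crossings outside the disc.\<close>

definition inner_indexed ::
    "tangle \<Rightarrow> (nat \<Rightarrow> real) \<Rightarrow> (nat \<Rightarrow> real) \<Rightarrow> mv_diagram \<Rightarrow> (vtype \<Rightarrow> real) \<Rightarrow>
      ((nat \<times> real) \<times> (nat \<times> real)) set" where
  "inner_indexed T c r D f =
     {(x, y) \<in> tangle_crossings T. mark D (param c r x) = Over \<and>
        (\<forall>a. vindex D a (param c r x) (param c r y) = f a)}"

section \<open>The position of a strand in the circular order\<close>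

lemma floor_eq_if_no_Ints:
  fixes x y :: real
  assumes "\<And>z. z \<in> \<int> \<Longrightarrow> min x y \<le> z \<Longrightarrow> z \<le> max x y \<Longrightarrow> False"
  shows "\<lfloor>x\<rfloor> = \<lfloor>y\<rfloor>"
proof (rule ccontr)
  assume "\<lfloor>x\<rfloor> \<noteq> \<lfloor>y\<rfloor>"
  then consider "\<lfloor>x\<rfloor> < \<lfloor>y\<rfloor>" | "\<lfloor>y\<rfloor> < \<lfloor>x\<rfloor>" by linarith
  then show False
  proof cases
    case 1
    then have "x < of_int \<lfloor>y\<rfloor>" "of_int \<lfloor>y\<rfloor> \<le> y" by (simp_all add: floor_less_iff)
    then show False
      by (intro assms[of "of_int \<lfloor>y\<rfloor>"]) (simp_all only: min_le_iff_disj le_max_iff_disj Ints_of_int less_imp_le simp_thms)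
  next
    case 2
    then have "y < of_int \<lfloor>x\<rfloor>" "of_int \<lfloor>x\<rfloor> \<le> x" by (simp_all add: floor_less_iff)
    then show False
      by (intro assms[of "of_int \<lfloor>x\<rfloor>"]) (simp_all only: min_le_iff_disj le_max_iff_disj Ints_of_int less_imp_le simp_thms)
  qed
qed

definition off_strand :: "(nat \<Rightarrow> real) \<Rightarrow> (nat \<Rightarrow> real) \<Rightarrow> nat \<Rightarrow> real \<Rightarrow> bool" where
  "off_strand c r i t \<longleftrightarrow> (\<forall>u\<in>{-1..1}. t - (c i + r i * u) \<notin> \<int>)"

lemma off_strand_outside: "\<not> on_strands c r k t \<Longrightarrow> i < k \<Longrightarrow> off_strand c r i t"
  by (auto simp: on_strands_def off_strand_def)

text \<open>\<open>\<rho>\<close> may be negative, as the diagram may run through a strand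
  backwards; hence the interval is given by \<open>min\<close> and \<open>max\<close>.\<close>

lemma between_scaled:
  fixes x \<rho> u :: real
  assumes "min x (x + \<rho> * u) \<le> z" "z \<le> max x (x + \<rho> * u)" "u \<in> {-1..1}"
  obtains w where "w \<in> {-1..1}" "z = x + \<rho> * w"
proof (cases "\<rho> = 0")
  case True
  then show ?thesis using assms that[of 0] by auto
next
  case False
  have "closed_segment x (x + \<rho> * u) = {min x (x + \<rho> * u)..max x (x + \<rho> * u)}"
    by (simp add: closed_segment_eq_real_ivl min_def max_def)
  then have "z \<in> closed_segment x (x + \<rho> * u)" using assms by simp
  then obtain l where l: "0 \<le> l" "l \<le> 1" "z = (1 - l) *\<^sub>R x + l *\<^sub>R (x + \<rho> * u)"
    by (auto simp: in_segment)
  have "\<bar>l * u\<bar> \<le> 1 * 1" unfolding abs_mult using l assms(3) by (intro mult_mono) auto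
  then show ?thesis using that[of "l * u"] l by (auto simp: algebra_simps abs_le_iff)
qed

text \<open>No integer is met on the way from the centre to \<open>u\<close>, as this would put
  \<open>t\<close> on the strand. So, seen from parameters off the strand, all its passages count as
  if they were at \<open>c i\<close>, and only the sum of their signs matters.\<close>

lemma floor_off_strand:
  assumes "off_strand c r i t" "u \<in> {-1..1}"
  shows "\<lfloor>t - (c i + r i * u)\<rfloor> = \<lfloor>t - c i\<rfloor>"
proof (rule floor_eq_if_no_Ints)
  fix z assume z: "z \<in> \<int>" "min (t - (c i + r i * u)) (t - c i) \<le> z" "z \<le> max (t - (c i + r i * u)) (t - c i)"
  then have "min (t - c i) ((t - c i) + (- r i) * u) \<le> z" "z \<le> max (t - c i) ((t - c i) + (- r i) * u)"
    by (simp_all add: min.commute max.commute algebra_simps)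
  then obtain w where w: "w \<in> {-1..1}" "z = (t - c i) + (- r i) * w"
    using assms(2) by (rule between_scaled)
  then have "t - (c i + r i * w) = z" by simp
  then show False using assms(1) z(1) w(1) unfolding off_strand_def by metis
qed

text \<open>The same with the roles exchanged: now \<open>t\<close> stands for a passage, and the
  strand carries an endpoint of the index.\<close>

lemma floor_off_strand':
  assumes "off_strand c r i t" "u \<in> {-1..1}"
  shows "\<lfloor>(c i + r i * u) - t\<rfloor> = \<lfloor>c i - t\<rfloor>"
proof (rule floor_eq_if_no_Ints)
  fix z assume z: "z \<in> \<int>" "min ((c i + r i * u) - t) (c i - t) \<le> z" "z \<le> max ((c i + r i * u) - t) (c i - t)"
  then have "min (c i - t) ((c i - t) + r i * u) \<le> z" "z \<le> max (c i - t) ((c i - t) + r i * u)"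
    by (simp_all add: min.commute max.commute algebra_simps)
  then obtain w where w: "w \<in> {-1..1}" "z = (c i - t) + r i * w"
    using assms(2) by (rule between_scaled)
  then have "t - (c i + r i * w) = - z" by simp
  then show False using assms(1) Ints_minus[OF z(1)] w(1) unfolding off_strand_def by metis
qed

text \<open>What a move says about one of its two diagrams. Both sides of \<open>replaces\<close>
  are instances with the same \<open>c\<close> and \<open>r\<close>, so each fact below is proved
  once for both.\<close>

locale embedded_tangle =
  fixes T :: tangle and c r :: "nat \<Rightarrow> real" and D :: mv_diagram
  assumes diagram: "is_diagram D"
    and r_nonzero: "\<And>i. i < length T \<Longrightarrow> r i \<noteq> 0"
    and disjoint: "\<And>i j u v. i < length T \<Longrightarrow> j < length T \<Longrightarrow> u \<in> {-1..1} \<Longrightarrow> v \<in> {-1..1} \<Longrightarrow>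
        (c i + r i * u) - (c j + r j * v) \<in> \<int> \<Longrightarrow> i = j \<and> u = v"
    and strand: "\<And>i u. i < length T \<Longrightarrow> u \<in> {-1..1} \<Longrightarrow> curve D (c i + r i * u) = (T ! i) u"
    and outside: "\<And>t. \<not> on_strands c r (length T) t \<Longrightarrow> curve D t \<notin> cball 0 1"
    and in_disc: "in_disc T"
begin

text \<open>Whether a parameter belongs to the tangle can be read off from its point in the plane.
  Hence the two passages of a crossing are both on strands or both off them, and all sums can be
  split at the disc.\<close>

lemma on_strands_iff: "on_strands c r (length T) t \<longleftrightarrow> curve D t \<in> cball 0 1"
proof
  assume "on_strands c r (length T) t"
  then obtain i u where iu: "i < length T" "u \<in> {-1..1}" "t - (c i + r i * u) \<in> \<int>"
    by (auto simp: on_strands_def)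
  then have "curve D t = (T ! i) u"
    using strand[OF iu(1,2)] curve_frac[OF diagram, of t] curve_frac[OF diagram, of "c i + r i * u"]
    by (simp add: Ints_diff_iff_frac_eq)
  then show "curve D t \<in> cball 0 1" using in_disc iu by (simp add: in_disc_def)
qed (use outside in blast)

lemma off_strand_other:
  "i < length T \<Longrightarrow> j < length T \<Longrightarrow> i \<noteq> j \<Longrightarrow> u \<in> {-1..1} \<Longrightarrow> off_strand c r j (c i + r i * u)"
  using disjoint by (auto simp: off_strand_def)

lemma bij_betw_inner:
  "bij_betw (\<lambda>(x, y). (frac (param c r x), frac (param c r y))) (tangle_crossings T)
     {(s, t) \<in> crossing_pairs D. curve D s \<in> cball 0 1}" (is "bij_betw ?h _ ?I")
  unfolding bij_betw_def
proof
  show "inj_on ?h (tangle_crossings T)"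
    by (rule inj_onI)
      (clarsimp simp: tangle_crossings_def Ints_diff_iff_frac_eq[symmetric], use disjoint in force)
  show "?h ` tangle_crossings T = ?I"
  proof (intro equalityI subsetI)
    fix p assume "p \<in> ?h ` tangle_crossings T"
    then obtain i u j v where p: "p = (frac (c i + r i * u), frac (c j + r j * v))"
      and iu: "i < length T" "u \<in> {-1..1}" and jv: "j < length T" "v \<in> {-1..1}"
      and ne: "(i, u) \<noteq> (j, v)" and eq: "(T ! i) u = (T ! j) v"
      by (auto simp: tangle_crossings_def)
    have "(c i + r i * u) - (c j + r j * v) \<notin> \<int>"
      using disjoint[OF iu(1) jv(1) iu(2) jv(2)] ne by auto
    then have "p \<in> crossing_pairs D"
      unfolding p frac_crossing_pair[OF diagram] using strand[OF iu] strand[OF jv] eq by simp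
    moreover have "curve D (frac (c i + r i * u)) \<in> cball 0 1"
      unfolding curve_frac[OF diagram] strand[OF iu] using in_disc iu by (simp add: in_disc_def)
    ultimately show "p \<in> ?I" by (simp add: p)
  next
    fix p assume p: "p \<in> ?I"
    obtain s t where st: "p = (s, t)" by (cases p)
    have on: "on_strands c r (length T) s" "on_strands c r (length T) t"
      using p unfolding on_strands_iff st crossing_pairs_def by auto
    then obtain i u j v where iu: "i < length T" "u \<in> {-1..1}" "s - (c i + r i * u) \<in> \<int>"
      and jv: "j < length T" "v \<in> {-1..1}" "t - (c j + r j * v) \<in> \<int>"
      by (auto simp: on_strands_def)
    have fr: "frac (c i + r i * u) = s" "frac (c j + r j * v) = t"
      using iu(3) jv(3) p unfolding Ints_diff_iff_frac_eq by (auto simp: st crossing_pairs_def frac_unit)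
    then have "(i, u) \<noteq> (j, v)" using p by (auto simp: st crossing_pairs_def)
    moreover have "(T ! i) u = (T ! j) v"
    proof -
      have "curve D s = curve D t" using p by (simp add: st crossing_pairs_def)
      then have "curve D (c i + r i * u) = curve D (c j + r j * v)"
        unfolding fr[symmetric] curve_frac[OF diagram] .
      then show ?thesis using strand[OF iu(1,2)] strand[OF jv(1,2)] by simp
    qed
    ultimately have "((i, u), (j, v)) \<in> tangle_crossings T"
      using iu jv by (auto simp: tangle_crossings_def)
    moreover have "p = ?h ((i, u), (j, v))" using fr st by simp
    ultimately show "p \<in> ?h ` tangle_crossings T" by (rule rev_image_eqI)
  qed
qed

lemma vindex_split: "vindex D a s t = outer_index D a s t + inner_index T c r D a s t"
proof -
  let ?I = "{(s, t) \<in> crossing_pairs D. curve D s \<in> cball 0 1}"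
  let ?g = "\<lambda>(q, q'). vsign D a q q' * of_int (\<lfloor>t - q\<rfloor> - \<lfloor>s - q\<rfloor>) :: real"
  have fin: "finite ?I" "finite (outer_pairs D)"
    unfolding outer_pairs_def
    by (rule finite_subset[OF _ finite_crossing_pairs[OF diagram]]; auto)+
  have "crossing_pairs D = outer_pairs D \<union> ?I" "outer_pairs D \<inter> ?I = {}"
    by (auto simp: outer_pairs_def)
  then have "vindex D a s t = sum ?g (outer_pairs D) + sum ?g ?I"
    using sum.union_disjoint[OF fin(2,1), of ?g] by (simp only: vindex_def)
  also have "sum ?g ?I = (\<Sum>p\<in>tangle_crossings T. ?g (case p of (x, y) \<Rightarrow> (frac (param c r x), frac (param c r y))))"
    by (rule sum.reindex_bij_betw[OF bij_betw_inner, symmetric])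
  also have "\<dots> = inner_index T c r D a s t"
    unfolding inner_index_def
    by (rule sum.cong[OF refl]) (simp only: case_prod_unfold fst_conv snd_conv floor_diff_frac vsign_frac[OF diagram])
  finally show ?thesis by (simp only: outer_index_def)
qed

text \<open>A passage outside the disc does not distinguish the points of one strand. So the outer
  part of the index of a tangle crossing depends only on the two strands involved; for
  \<open>i = j\<close> it vanishes.\<close>

lemma outer_index_strands:
  assumes "i < length T" "u \<in> {-1..1}" "j < length T" "v \<in> {-1..1}"
  shows "outer_index D a (c i + r i * u) (c j + r j * v) = outer_index D a (c i) (c j)"
  unfolding outer_index_def
proof (rule sum.cong[OF refl])
  fix p assume "p \<in> outer_pairs D"
  then obtain q q' where p: "p = (q, q')" and "\<not> on_strands c r (length T) q"
    unfolding on_strands_iff by (auto simp: outer_pairs_def)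
  then have "off_strand c r i q" "off_strand c r j q" using off_strand_outside assms by auto
  then show "(case p of (q, q') \<Rightarrow> vsign D a q q' * real_of_int (\<lfloor>c j + r j * v - q\<rfloor> - \<lfloor>c i + r i * u - q\<rfloor>))
    = (case p of (q, q') \<Rightarrow> vsign D a q q' * real_of_int (\<lfloor>c j - q\<rfloor> - \<lfloor>c i - q\<rfloor>))"
    using floor_off_strand' assms by (simp add: p)
qed

lemma card_indexed_crossings_split:
  "card (indexed_crossings D f) =
     card (indexed_crossings D f \<inter> outer_pairs D) + card (inner_indexed T c r D f)"
proof -
  let ?I = "{(s, t) \<in> crossing_pairs D. curve D s \<in> cball 0 1}"
  let ?h = "\<lambda>(x, y). (frac (param c r x), frac (param c r y))"
  have sub: "indexed_crossings D f \<subseteq> crossing_pairs D" by (auto simp: indexed_crossings_def)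
  have fin: "finite (indexed_crossings D f)"
    using sub finite_crossing_pairs[OF diagram] by (rule finite_subset)
  have "indexed_crossings D f = (indexed_crossings D f \<inter> outer_pairs D) \<union> (indexed_crossings D f \<inter> ?I)"
    using sub by (auto simp: outer_pairs_def)
  moreover have "(indexed_crossings D f \<inter> outer_pairs D) \<inter> (indexed_crossings D f \<inter> ?I) = {}"
    by (auto simp: outer_pairs_def)
  ultimately have "card (indexed_crossings D f) = card (indexed_crossings D f \<inter> outer_pairs D) + card (indexed_crossings D f \<inter> ?I)"
    using card_Un_disjoint[of "indexed_crossings D f \<inter> outer_pairs D" "indexed_crossings D f \<inter> ?I"] fin by simp
  moreover have "bij_betw ?h (inner_indexed T c r D f) (indexed_crossings D f \<inter> ?I)"
  proof -
    have mem: "?h p \<in> indexed_crossings D f \<longleftrightarrow> p \<in> inner_indexed T c r D f" if "p \<in> tangle_crossings T" for p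
    proof -
      have "?h p \<in> ?I" using bij_betwE[OF bij_betw_inner] that by (rule bspec)
      then have "?h p \<in> crossing_pairs D" by (cases p) simp
      then show ?thesis using that
        by (cases p) (simp add: indexed_crossings_def inner_indexed_def vindex_frac[OF diagram] mark_frac[OF diagram])
    qed
    have "inner_indexed T c r D f \<subseteq> tangle_crossings T" by (auto simp: inner_indexed_def)
    moreover have "?h ` inner_indexed T c r D f = indexed_crossings D f \<inter> ?I"
    proof (intro equalityI subsetI)
      fix q assume q: "q \<in> indexed_crossings D f \<inter> ?I"
      then have "q \<in> ?h ` tangle_crossings T"
        unfolding bij_betw_imp_surj_on[OF bij_betw_inner] by (rule IntD2)
      then obtain p where p: "q = ?h p" "p \<in> tangle_crossings T" by (rule imageE)
      have "p \<in> inner_indexed T c r D f"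
        using IntD1[OF q] unfolding p(1) mem[OF p(2)] .
      with p(1) show "q \<in> ?h ` inner_indexed T c r D f" by (rule image_eqI)
    next
      fix q assume "q \<in> ?h ` inner_indexed T c r D f"
      then obtain p where p: "q = ?h p" "p \<in> inner_indexed T c r D f" by blast
      then have pT: "p \<in> tangle_crossings T" by (auto simp: inner_indexed_def)
      have "?h p \<in> indexed_crossings D f" using p(2) unfolding mem[OF pT] .
      moreover have "?h p \<in> ?I" using bij_betwE[OF bij_betw_inner] pT by (rule bspec)
      ultimately show "q \<in> indexed_crossings D f \<inter> ?I" unfolding p(1) by (rule IntI)
    qed
    ultimately show ?thesis by (rule bij_betw_subset[OF bij_betw_inner])
  qed
  ultimately show ?thesis using bij_betw_same_card[of ?h] by simp
qed

text \<open>Near an interior parameter the curve is the strand composed with the inverse of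
  \<open>c i + r i * u\<close>. At an end of the strand the tangle would determine only a one-sided
  derivative, hence the open interval.\<close>

lemma velocity_strand:
  assumes "i < length T" "u \<in> {-1<..<1}" "((T ! i) has_vector_derivative d) (at u)"
  shows "velocity D (c i + r i * u) = d /\<^sub>R r i"
proof (rule velocity_unique)
  let ?w = "\<lambda>t. (t - c i) / r i"
  let ?S = "?w -` {-1<..<1}"
  have r: "r i \<noteq> 0" using r_nonzero assms(1) .
  have "(?w has_vector_derivative inverse (r i)) (at (c i + r i * u))"
    using r by (auto simp: has_real_derivative_iff_has_vector_derivative[symmetric] divide_inverse
        intro!: derivative_eq_intros)
  moreover have "((T ! i) has_vector_derivative d) (at (?w (c i + r i * u)))"
    using assms(3) r by simp
  ultimately have "((T ! i) \<circ> ?w has_vector_derivative inverse (r i) *\<^sub>R d) (at (c i + r i * u))"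
    by (rule vector_diff_chain_at)
  moreover have "open ?S"
    by (rule open_vimage) (auto intro!: continuous_intros simp: r)
  moreover have "c i + r i * u \<in> ?S" using assms(2) r by simp
  moreover have "((T ! i) \<circ> ?w) t = curve D t" if "t \<in> ?S" for t
    using strand[OF assms(1), of "?w t"] that r by simp
  ultimately show "(curve D has_vector_derivative d /\<^sub>R r i) (at (c i + r i * u))"
    by (rule has_vector_derivative_transform_within_open)
qed

text \<open>Of the speeds only the signs survive: the sign of a passage is that of the standard
  picture, corrected once for each strand that is run through backwards.\<close>

lemma vsign_strands:
  assumes "i < length T" "u \<in> {-1<..<1}" "((T ! i) has_vector_derivative d) (at u)"
    and "j < length T" "v \<in> {-1<..<1}" "((T ! j) has_vector_derivative e) (at v)"
    and "Im (cnj d * e) = x"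
  shows "vsign D a (c i + r i * u) (c j + r j * v) =
    (if mark D (c i + r i * u) = Virt a then sgn (r i) * sgn (r j) * sgn x else 0)"
proof -
  have "Im (cnj (velocity D (c i + r i * u)) * velocity D (c j + r j * v)) = inverse (r i) * inverse (r j) * x"
    unfolding velocity_strand[OF assms(1-3)] velocity_strand[OF assms(4-6)] assms(7)[symmetric]
    by (simp add: algebra_simps)
  then show ?thesis by (simp only: vsign_def sgn_mult sgn_inverse)
    (simp add: sgn_if)
qed

end

section \<open>The two diagrams of a move compared\<close>

lemma replaces_embedded:
  assumes "replaces T T' c r D D'" "in_disc T" "in_disc T'"
  shows "embedded_tangle T c r D" "embedded_tangle T' c r D'" "length T = length T'"
    "\<And>t. \<not> on_strands c r (length T) t \<Longrightarrow> curve D' t = curve D t \<and> mark D' t = mark D t"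
proof -
  have out: "curve D' t = curve D t \<and> mark D' t = mark D t \<and> curve D t \<notin> cball 0 1"
    if "\<not> on_strands c r (length T) t" for t
    using assms(1) that by (auto simp: replaces_def)
  have len: "length T = length T'" using assms(1) by (simp add: replaces_def)
  have disj: "i = j \<and> u = v" if "i < length T" "j < length T" "u \<in> {-1..1}" "v \<in> {-1..1}"
    "(c i + r i * u) - (c j + r j * v) \<in> \<int>" for i j u v
    using assms(1) that unfolding replaces_def by blast
  have str: "curve D (c i + r i * u) = (T ! i) u \<and> curve D' (c i + r i * u) = (T' ! i) u"
    if "i < length T" "u \<in> {-1..1}" for i u
    using assms(1) that unfolding replaces_def by blast
  show "embedded_tangle T c r D"
  proof
    show "curve D t \<notin> cball 0 1" if "\<not> on_strands c r (length T) t" for t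
      using out that by blast
  qed (use disj str assms in \<open>auto simp: replaces_def\<close>)
  show "embedded_tangle T' c r D'"
  proof
    show "curve D' t \<notin> cball 0 1" if "\<not> on_strands c r (length T') t" for t
      using out[of t] that by (simp add: len)
  qed (use disj str assms in \<open>auto simp: replaces_def\<close>)
  show "length T = length T'" by (rule len)
  show "curve D' t = curve D t \<and> mark D' t = mark D t" if "\<not> on_strands c r (length T) t" for t
    using out that by blast
qed

lemma outer_replaced:
  assumes R: "replaces T T' c r D D'" "in_disc T" "in_disc T'"
  shows "outer_pairs D' = outer_pairs D"
    and "outer_index D' a s t = outer_index D a s t"
    and "p \<in> outer_pairs D \<Longrightarrow> mark D' (fst p) = mark D (fst p)"
proof -
  interpret D: embedded_tangle T c r D by (rule replaces_embedded[OF R])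
  interpret D': embedded_tangle T' c r D' by (rule replaces_embedded[OF R])
  note len = replaces_embedded(3)[OF R] and eq = replaces_embedded(4)[OF R]
  have out: "curve D' t \<notin> cball 0 1 \<longleftrightarrow> curve D t \<notin> cball 0 1" for t
    using D.on_strands_iff D'.on_strands_iff len by simp
  have curve: "curve D' t = curve D t" and mark: "mark D' t = mark D t" if "curve D t \<notin> cball 0 1" for t
    using eq[of t] that D.on_strands_iff by auto
  show outer: "outer_pairs D' = outer_pairs D"
    using out curve by (fastforce simp: outer_pairs_def crossing_pairs_def)
  \<comment> \<open>Equal values at \<open>t\<close> alone would not give equal derivatives; the
    curves agree near \<open>t\<close> because the complement of the closed disc is open.\<close>
  have vel: "velocity D' t = velocity D t" if "curve D t \<notin> cball 0 1" for t
  proof (rule velocity_unique, rule has_vector_derivative_transform_within_open)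
    show "(curve D has_vector_derivative velocity D t) (at t)"
      by (rule has_vector_derivative_velocity[OF D.diagram])
    show "open (curve D -` (- cball 0 1))"
      by (rule open_vimage) (use continuous_curve[OF D.diagram] in auto)
  qed (use that curve in auto)
  have outer_out: "curve D q \<notin> cball 0 1" "curve D q' \<notin> cball 0 1" if "(q, q') \<in> outer_pairs D" for q q'
    using that by (auto simp: outer_pairs_def crossing_pairs_def)
  show "outer_index D' a s t = outer_index D a s t"
    unfolding outer_index_def outer
  proof (rule sum.cong[OF refl])
    fix p assume "p \<in> outer_pairs D"
    moreover obtain q q' where p: "p = (q, q')" by (cases p)
    ultimately have "curve D q \<notin> cball 0 1" "curve D q' \<notin> cball 0 1" using outer_out by blast+
    then have "mark D' q = mark D q" "velocity D' q = velocity D q" "velocity D' q' = velocity D q'"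
      using mark vel by blast+
    then have "vsign D' a q q' = vsign D a q q'" by (simp only: vsign_def)
    then show "(case p of (q, q') \<Rightarrow> vsign D' a q q' * real_of_int (\<lfloor>t - q\<rfloor> - \<lfloor>s - q\<rfloor>))
      = (case p of (q, q') \<Rightarrow> vsign D a q q' * real_of_int (\<lfloor>t - q\<rfloor> - \<lfloor>s - q\<rfloor>))"
      by (simp add: p)
  qed
  show "p \<in> outer_pairs D \<Longrightarrow> mark D' (fst p) = mark D (fst p)"
    by (cases p) (auto simp: mark dest: outer_out)
qed

text \<open>Every move is reduced to two checks on its tangles: they contribute equally to indices
  between parameters off the strands, and their own crossings of index \<open>f\<close> have the
  same parity.\<close>

lemma parity_replaced:
  assumes R: "replaces T T' c r D D'" "in_disc T" "in_disc T'"
    and inner_eq: "\<And>a s t. \<not> on_strands c r (length T) s \<Longrightarrow> \<not> on_strands c r (length T) t \<Longrightarrow>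
        inner_index T c r D a s t = inner_index T' c r D' a s t"
    and parity: "even (card (inner_indexed T c r D f)) = even (card (inner_indexed T' c r D' f))"
  shows "even (card (indexed_crossings D f)) = even (card (indexed_crossings D' f))"
proof -
  interpret D: embedded_tangle T c r D by (rule replaces_embedded[OF R])
  interpret D': embedded_tangle T' c r D' by (rule replaces_embedded[OF R])
  note outer = outer_replaced[OF R]
  have "p \<in> indexed_crossings D' f \<longleftrightarrow> p \<in> indexed_crossings D f" if p: "p \<in> outer_pairs D" for p
  proof -
    obtain s t where st: "p = (s, t)" by (cases p)
    have "(s, t) \<in> crossing_pairs D" "(s, t) \<in> crossing_pairs D'"
      using p outer(1) by (auto simp: st outer_pairs_def)
    moreover have "\<not> on_strands c r (length T) s" "\<not> on_strands c r (length T) t"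
      using p unfolding D.on_strands_iff by (auto simp: st outer_pairs_def crossing_pairs_def)
    then have "vindex D' a s t = vindex D a s t" for a
      by (simp add: D.vindex_split D'.vindex_split outer(2) inner_eq)
    ultimately show ?thesis using outer(3)[OF p] by (simp add: st indexed_crossings_def)
  qed
  then have "indexed_crossings D' f \<inter> outer_pairs D' = indexed_crossings D f \<inter> outer_pairs D"
    unfolding outer(1) by blast
  then show ?thesis
    using parity D.card_indexed_crossings_split D'.card_indexed_crossings_split by simp
qed

section \<open>The crossings of the Reidemeister tangles\<close>

lemma has_vector_derivative_Complex:
  assumes "(f has_real_derivative f') (at u)" "(g has_real_derivative g') (at u)"
  shows "((\<lambda>u. Complex (f u) (g u)) has_vector_derivative Complex f' g') (at u)"
proof -
  have "((\<lambda>u. f u *\<^sub>R 1 + g u *\<^sub>R \<i>) has_vector_derivative (f u *\<^sub>R 0 + f' *\<^sub>R 1) + (g u *\<^sub>R 0 + g' *\<^sub>R \<i>)) (at u)"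
    by (intro has_vector_derivative_add has_vector_derivative_scaleR assms has_vector_derivative_const)
  moreover have "x *\<^sub>R 1 + y *\<^sub>R \<i> = Complex x y" for x y by (simp add: complex_eq_iff)
  ultimately show ?thesis by simp
qed

lemma tangle_crossings_iff:
  "((i, u), (j, v)) \<in> tangle_crossings T \<longleftrightarrow>
     i < length T \<and> j < length T \<and> (i, u) \<noteq> (j, v) \<and>
       u \<in> {-1..1} \<and> v \<in> {-1..1} \<and> (T ! i) u = (T ! j) v"
  by (simp add: tangle_crossings_def) blast

lemma subset_pairsI:
  assumes "\<And>i u j v. ((i, u), (j, v)) \<in> A \<Longrightarrow> ((i, u), (j, v)) \<in> B"
  shows "A \<subseteq> B"
  using assms by auto

lemma marked_crossing:
  assumes "marked T c r L D" "((i, u), (j, v)) \<in> tangle_crossings T"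
  shows "mark D (c i + r i * u) = L i u j v"
  using assms unfolding marked_def tangle_crossings_iff by blast

lemma inner_index_eq_0:
  assumes "\<And>x y. (x, y) \<in> tangle_crossings T \<Longrightarrow> mark D (param c r x) \<noteq> Virt a"
  shows "inner_index T c r D a s t = 0"
  unfolding inner_index_def by (rule sum.neutral) (auto simp: vsign_def dest: assms)

lemma inner_indexed_eq_empty:
  assumes "\<And>x y. (x, y) \<in> tangle_crossings T \<Longrightarrow> mark D (param c r x) \<noteq> Over"
  shows "inner_indexed T c r D f = {}"
  using assms by (auto simp: inner_indexed_def)

lemma outer_index_same: "outer_index D a s s = 0"
  by (simp add: outer_index_def)

lemma inner_index_swap: "inner_index T c r D a s t = - inner_index T c r D a t s"
  unfolding inner_index_def sum_negf[symmetric] by (rule sum.cong) (auto simp: algebra_simps)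

lemma norm_Complex_le_1: "x\<^sup>2 + y\<^sup>2 \<le> 1 \<Longrightarrow> cmod (Complex x y) \<le> 1"
  by (simp add: cmod_def)

lemma square_le_1: "u \<in> {-1..1} \<Longrightarrow> u\<^sup>2 \<le> (1::real)"
  by (simp add: abs_le_iff abs_square_le_1)

section \<open>The tangles stay in the unit disc\<close>

lemma in_disc_R1_plain: "in_disc R1_plain"
  unfolding in_disc_def R1_plain_def
  by (auto intro!: norm_Complex_le_1 simp: square_le_1)

lemma in_disc_R1_kink: "in_disc R1_kink"
proof -
  have "(u * (1 - 2 * (1 - u\<^sup>2)\<^sup>2))\<^sup>2 + ((1 - u\<^sup>2)\<^sup>2)\<^sup>2 \<le> 1" if "u \<in> {-1..1}" for u :: real
  proof -
    \<comment> \<open>In terms of \<open>w\<close>, 1 minus the squared norm factors as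
      \<open>w * (1 - w) * (1 + 5 * w + w\<^sup>2 - 4 * w ^ 3)\<close>. The last factor is at least
      1 because \<open>w ^ 3 \<le> w\<close>.\<close>
    define w where "w = 1 - u\<^sup>2"
    have w: "0 \<le> w" "w \<le> 1" using square_le_1[OF that] by (auto simp: w_def)
    have "w ^ 3 \<le> w" using w power_decreasing[of 1 3 w] by simp
    then have "0 \<le> 1 + 5 * w + w\<^sup>2 - 4 * w ^ 3" using w zero_le_power2[of w] by linarith
    then have "0 \<le> w * (1 - w) * (1 + 5 * w + w\<^sup>2 - 4 * w ^ 3)" using w by (intro mult_nonneg_nonneg) auto
    moreover have "(u * (1 - 2 * (1 - u\<^sup>2)\<^sup>2))\<^sup>2 + ((1 - u\<^sup>2)\<^sup>2)\<^sup>2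
      = (1 - w) * (1 - 2 * w\<^sup>2)\<^sup>2 + (w\<^sup>2)\<^sup>2"
      by (simp add: w_def power_mult_distrib)
    moreover have "\<dots> = 1 - w * (1 - w) * (1 + 5 * w + w\<^sup>2 - 4 * w ^ 3)"
      by (simp add: power2_eq_square power3_eq_cube algebra_simps)
    ultimately show ?thesis by linarith
  qed
  then show ?thesis
    unfolding in_disc_def R1_kink_def by (auto intro!: norm_Complex_le_1)
qed

lemma in_disc_R2_plain: "in_disc R2_plain"
proof -
  have "(4 / 5 * u)\<^sup>2 + (3 / 5)\<^sup>2 \<le> 1" if "u \<in> {-1..1}" for u :: real
    using square_le_1[OF that] by (simp add: power_mult_distrib power_divide)
  then show ?thesis
    unfolding in_disc_def R2_plain_def
    by (auto intro!: norm_Complex_le_1 simp: less_Suc_eq square_le_1)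
qed

lemma in_disc_R2_bigon: "in_disc R2_bigon"
proof -
  have "(4 / 5 * u)\<^sup>2 + (3 / 5 * (1 - 2 * (1 - u\<^sup>2)\<^sup>2))\<^sup>2 \<le> 1" if "u \<in> {-1..1}" for u :: real
  proof -
    have "(1 - u\<^sup>2)\<^sup>2 \<le> 1" using square_le_1[OF that] by (intro square_le_1) auto
    moreover define y where "y = 1 - 2 * (1 - u\<^sup>2)\<^sup>2"
    ultimately have "y\<^sup>2 \<le> 1" by (intro square_le_1) auto
    then show ?thesis using square_le_1[OF that]
      unfolding y_def[symmetric] by (simp add: power_mult_distrib power_divide)
  qed
  then show ?thesis
    unfolding in_disc_def R2_bigon_def
    by (auto intro!: norm_Complex_le_1 simp: less_Suc_eq square_le_1)
qed

lemma in_disc_R3: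
  assumes "e \<in> {1, -1}"
  shows "in_disc (R3_tangle e)"
proof -
  have "u\<^sup>2 + (e * (1 - u\<^sup>2)\<^sup>2)\<^sup>2 \<le> 1" if "u \<in> {-1..1}" for u :: real
  proof -
    have w: "0 \<le> 1 - u\<^sup>2" "1 - u\<^sup>2 \<le> 1" using square_le_1[OF that] by auto
    have "e\<^sup>2 = 1" using assms by auto
    then have "(e * (1 - u\<^sup>2)\<^sup>2)\<^sup>2 = (1 - u\<^sup>2) ^ 4" by (simp add: power_mult_distrib)
    also have "\<dots> \<le> (1 - u\<^sup>2) ^ 1" using w by (intro power_decreasing) auto
    finally show ?thesis by simp
  qed
  moreover have "(4 / 5 * u)\<^sup>2 + (3 / 5 * u)\<^sup>2 \<le> 1" "(4 / 5 * u)\<^sup>2 + (- 3 / 5 * u)\<^sup>2 \<le> 1"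
    if "u \<in> {-1..1}" for u :: real
    using square_le_1[OF that] by (simp_all add: power_mult_distrib power_divide)
  ultimately show ?thesis
    unfolding in_disc_def R3_tangle_def
    by (auto intro!: norm_Complex_le_1 simp: less_Suc_eq)
qed

section \<open>Where the strands meet\<close>

lemma tangle_crossings_R1_plain: "tangle_crossings R1_plain = {}"
  by (auto simp: tangle_crossings_def R1_plain_def)

lemma tangle_crossings_R2_plain: "tangle_crossings R2_plain = {}"
  by (auto simp: tangle_crossings_def R2_plain_def less_Suc_eq)

text \<open>
  The kink meets itself at the parameters \<open>\<plusminus>kink_pos\<close>, and these are also the parameters at which the
  curved strand of the bigon meets the straight one.
\<close>

definition kink_pos :: real where "kink_pos = sqrt (1 - sqrt (1 / 2))"

lemma kink_pos_bounds: "0 < kink_pos" "kink_pos < 1"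
  by (auto simp: kink_pos_def real_sqrt_lt_1_iff)

text \<open>These are the zeros of \<open>1 - 2 * (1 - u\<^sup>2)\<^sup>2\<close>, a factor both of
  the abscissa of the kink and of the height of the curved strand of the bigon. On
  \<open>{-1..1}\<close> the number \<open>1 - u\<^sup>2\<close> is nonnegative, so only one square
  root of 1/2 is possible.\<close>

lemma kink_pos_iff:
  assumes "u \<in> {-1..1}"
  shows "(1 - u\<^sup>2)\<^sup>2 = 1 / 2 \<longleftrightarrow> u = kink_pos \<or> u = - kink_pos"
proof -
  have k: "kink_pos\<^sup>2 = 1 - sqrt (1 / 2)" by (simp add: kink_pos_def)
  have "(1 - u\<^sup>2)\<^sup>2 = 1 / 2 \<longleftrightarrow> 1 - u\<^sup>2 = sqrt (1 / 2)"
    using square_le_1[OF assms] by (metis diff_ge_0_iff_ge real_sqrt_abs abs_of_nonneg real_sqrt_pow2 zero_le_divide_1_iff zero_le_numeral)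
  also have "\<dots> \<longleftrightarrow> u\<^sup>2 = kink_pos\<^sup>2" by (auto simp: k)
  finally show ?thesis by (simp add: power2_eq_iff)
qed

lemma kink_pos_eq: "(1 - kink_pos\<^sup>2)\<^sup>2 = 1 / 2"
  using kink_pos_iff[of kink_pos] kink_pos_bounds by auto

lemma tangle_crossings_R1_kink:
  "tangle_crossings R1_kink = {((0, kink_pos), (0, - kink_pos)), ((0, - kink_pos), (0, kink_pos))}"
proof -
  have "v = - u \<and> (u = kink_pos \<or> u = - kink_pos)"
    if uv: "u \<in> {-1..1}" "v \<in> {-1..1}" "u \<noteq> v"
      and y: "(1 - u\<^sup>2)\<^sup>2 = (1 - v\<^sup>2)\<^sup>2" and x: "u * (1 - 2 * (1 - u\<^sup>2)\<^sup>2) = v * (1 - 2 * (1 - v\<^sup>2)\<^sup>2)" for u v :: real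
  proof -
    \<comment> \<open>Equal heights leave only \<open>v = - u\<close>; the abscissa is an odd
      function of the parameter, so it has to vanish at \<open>u \<noteq> 0\<close>.\<close>
    have "1 - u\<^sup>2 = 1 - v\<^sup>2"
      using y square_le_1[OF uv(1)] square_le_1[OF uv(2)] by (simp add: power2_eq_iff_nonneg)
    then have "u = v \<or> u = - v" by (simp add: power2_eq_iff)
    then have v: "v = - u" using uv(3) by auto
    then have "u \<noteq> 0" using uv(3) by auto
    moreover have "u * (1 - 2 * (1 - u\<^sup>2)\<^sup>2) = 0" using x by (simp add: v)
    ultimately have "(1 - u\<^sup>2)\<^sup>2 = 1 / 2" by simp
    then show ?thesis using kink_pos_iff[OF uv(1)] v by simp
  qed
  note meet = this
  have "((0, u), (0, v)) \<in> {((0, kink_pos), (0, - kink_pos)), ((0, - kink_pos), (0, kink_pos))}"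
    if "((0, u), (0, v)) \<in> tangle_crossings R1_kink" for u v
  proof -
    have "u \<in> {-1..1}" "v \<in> {-1..1}" "u \<noteq> v" "(1 - u\<^sup>2)\<^sup>2 = (1 - v\<^sup>2)\<^sup>2"
      "u * (1 - 2 * (1 - u\<^sup>2)\<^sup>2) = v * (1 - 2 * (1 - v\<^sup>2)\<^sup>2)"
      using that unfolding tangle_crossings_iff R1_kink_def nth_Cons_0 complex.inject prod.inject
      by blast+
    from meet[OF this] show ?thesis by auto
  qed
  moreover have "i = 0 \<and> j = 0" if "((i, u), (j, v)) \<in> tangle_crossings R1_kink" for i u j v
    using that by (simp add: tangle_crossings_iff R1_kink_def)
  moreover have "{((0, kink_pos), (0, - kink_pos)), ((0, - kink_pos), (0, kink_pos))} \<subseteq> tangle_crossings R1_kink"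
    using kink_pos_bounds by (simp add: tangle_crossings_iff R1_kink_def kink_pos_eq)
  ultimately show ?thesis by (fast intro!: equalityI)
qed

lemma tangle_crossings_R2_bigon:
  "tangle_crossings R2_bigon =
    {((0, 4/5 * kink_pos), (1, kink_pos)), ((1, kink_pos), (0, 4/5 * kink_pos)),
     ((0, - 4/5 * kink_pos), (1, - kink_pos)), ((1, - kink_pos), (0, - 4/5 * kink_pos))}" (is "_ = ?X")
proof -
  define S0 S1 where "S0 = R2_bigon ! 0" and "S1 = R2_bigon ! Suc 0"
  have S0: "S0 u = S0 v \<longleftrightarrow> u = v" and S1: "S1 u = S1 v \<longleftrightarrow> u = v" for u v
    by (auto simp: S0_def S1_def R2_bigon_def)
  have "S0 u = S1 v \<longleftrightarrow> u = 4/5 * v \<and> (v = kink_pos \<or> v = - kink_pos)" if "v \<in> {-1..1}" for u v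
    unfolding S0_def S1_def R2_bigon_def kink_pos_iff[OF that, symmetric] by auto
  then have S01: "u \<in> {-1..1} \<and> v \<in> {-1..1} \<and> S0 u = S1 v \<longleftrightarrow>
      u = 4/5 * kink_pos \<and> v = kink_pos \<or> u = - 4/5 * kink_pos \<and> v = - kink_pos" for u v
    using kink_pos_bounds by auto
  have S10: "v \<in> {-1..1} \<and> u \<in> {-1..1} \<and> S1 v = S0 u \<longleftrightarrow>
      u = 4/5 * kink_pos \<and> v = kink_pos \<or> u = - 4/5 * kink_pos \<and> v = - kink_pos" for u v
    using S01[of u v] by (simp only: conj_commute[of "v \<in> _"] conj_assoc eq_commute[of "S1 v"])
  have len: "length R2_bigon = 2" by (simp add: R2_bigon_def)
  have "((i, u), (j, v)) \<in> ?X" if ij: "((i, u), (j, v)) \<in> tangle_crossings R2_bigon" for i u j v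
  proof -
    have uv: "(i, u) \<noteq> (j, v)" "u \<in> {-1..1} \<and> v \<in> {-1..1} \<and> (R2_bigon ! i) u = (R2_bigon ! j) v"
      and "i < 2" "j < 2"
      using ij unfolding tangle_crossings_iff len by blast+
    then consider "i = 0" "j = 0" | "i = 0" "j = Suc 0" | "i = Suc 0" "j = 0" | "i = Suc 0" "j = Suc 0"
      by linarith
    then show ?thesis
    proof cases
      case 1 with uv S0 show ?thesis by (simp add: S0_def)
    next
      case 2
      then show ?thesis using iffD1[OF S01[of u v]] uv(2) unfolding S0_def S1_def by auto
    next
      case 3
      then show ?thesis using iffD1[OF S10[of u v]] uv(2) unfolding S0_def S1_def by auto
    next
      case 4 with uv S1 show ?thesis by (simp add: S1_def)
    qed
  qed
  moreover have "?X \<subseteq> tangle_crossings R2_bigon"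
    using S01[of "4/5 * kink_pos" kink_pos] S01[of "- 4/5 * kink_pos" "- kink_pos"]
      S10[of kink_pos "4/5 * kink_pos"] S10[of "- kink_pos" "- 4/5 * kink_pos"]
    unfolding insert_subset tangle_crossings_iff len S0_def S1_def One_nat_def
    by (simp del: atLeastAtMost_iff)
  ultimately show ?thesis by (rule equalityI[OF subset_pairsI])
qed

text \<open>At abscissa \<open>u\<close> strand 0 has height \<open>3/4 * u\<close> and strand 2 has
  height \<open>(1 - u\<^sup>2)\<^sup>2\<close>. The difference increases on \<open>{0..1}\<close>,
  is -1 at 0 and positive at 4/5; a negative \<open>u\<close> cannot equal a square. The bound 4/5
  keeps the parameter \<open>5/4 * x\<close> on strand 0 below 1.\<close>

lemma slide_pos_exists:
  obtains x :: real where "0 < x" "x < 4/5"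
    "\<And>u. u \<in> {-1..1} \<Longrightarrow> (1 - u\<^sup>2)\<^sup>2 = 3/4 * u \<longleftrightarrow> u = x"
proof -
  let ?f = "\<lambda>x::real. 3/4 * x - (1 - x\<^sup>2)\<^sup>2"
  have "continuous_on {0..4/5} ?f" by (intro continuous_intros)
  then obtain x where x: "0 \<le> x" "x \<le> 4/5" "?f x = 0"
    using IVT'[of ?f 0 0 "4/5"] by (auto simp: power2_eq_square)
  have strict: "?f u < ?f v" if "0 \<le> u" "u < v" "v \<le> 1" for u v
  proof -
    have "u\<^sup>2 < v\<^sup>2" using that by (intro power_strict_mono) auto
    moreover have "v\<^sup>2 \<le> 1" using that by (intro square_le_1) auto
    ultimately have "(1 - v\<^sup>2)\<^sup>2 \<le> (1 - u\<^sup>2)\<^sup>2" by (intro power_mono) auto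
    then show ?thesis using that by linarith
  qed
  show ?thesis
  proof (rule that[of x])
    show "0 < x" using x by (cases "x = 0") auto
    show "x < 4/5" using x by (cases "x = 4/5") (auto simp: power2_eq_square)
    fix u :: real assume u: "u \<in> {-1..1}"
    show "(1 - u\<^sup>2)\<^sup>2 = 3/4 * u \<longleftrightarrow> u = x"
    proof
      assume eq: "(1 - u\<^sup>2)\<^sup>2 = 3/4 * u"
      then have "0 \<le> u" using zero_le_power2[of "1 - u\<^sup>2"] by linarith
      then show "u = x"
        using strict[of u x] strict[of x u] x eq u by (cases u x rule: linorder_cases) auto
    qed (use x in simp)
  qed
qed

text \<open>\<open>slide_pos\<close> is the abscissa at which strand 2 of \<open>R3_tangle 1\<close> meets strand 0.\<close>

definition slide_pos :: real where
  "slide_pos = (SOME x. 0 < x \<and> x < 4/5 \<and> (\<forall>u\<in>{-1..1}. (1 - u\<^sup>2)\<^sup>2 = 3/4 * u \<longleftrightarrow> u = x))"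

lemma
  shows slide_pos_pos: "0 < slide_pos" and slide_pos_less: "slide_pos < 4/5"
    and slide_pos_iff: "u \<in> {-1..1} \<Longrightarrow> (1 - u\<^sup>2)\<^sup>2 = 3/4 * u \<longleftrightarrow> u = slide_pos"
proof -
  have "\<exists>x::real. 0 < x \<and> x < 4/5 \<and> (\<forall>u\<in>{-1..1}. (1 - u\<^sup>2)\<^sup>2 = 3/4 * u \<longleftrightarrow> u = x)"
    by (rule slide_pos_exists) blast
  from someI_ex[OF this] show "0 < slide_pos" "slide_pos < 4/5"
    "u \<in> {-1..1} \<Longrightarrow> (1 - u\<^sup>2)\<^sup>2 = 3/4 * u \<longleftrightarrow> u = slide_pos"
    unfolding slide_pos_def by blast+
qed

text \<open>
  \<open>R3_pos e i j\<close> is the parameter at which strand \<open>i\<close> of \<open>R3_tangle e\<close> meets strand \<open>j\<close>, and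
  \<open>R3_sign i j\<close> is the sign of the determinant of their velocities there; it is the same before and
  after the move.
\<close>

definition R3_pos :: "real \<Rightarrow> nat \<Rightarrow> nat \<Rightarrow> real" where
  "R3_pos e i j =
     (if i + j = 1 then 0
      else if i = 0 then 5/4 * (e * slide_pos) else if i = 1 then - 5/4 * (e * slide_pos)
      else if j = 0 then e * slide_pos else - (e * slide_pos))"

definition R3_sign :: "nat \<Rightarrow> nat \<Rightarrow> real" where
  "R3_sign i j = (if (i, j) \<in> {(0, 1), (0, 2), (2, 1)} then - 1 else 1)"

text \<open>Any two strands meet exactly once, so an ordered pair of strands names a crossing pair
  on either side of the move, and the sums before and after run over the same set.\<close>

definition R3_crossing :: "real \<Rightarrow> nat \<times> nat \<Rightarrow> (nat \<times> real) \<times> (nat \<times> real)" where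
  "R3_crossing e = (\<lambda>(i, j). ((i, R3_pos e i j), (j, R3_pos e j i)))"

abbreviation R3_strands :: "(nat \<times> nat) set" where
  "R3_strands \<equiv> {(0, 1), (1, 0), (0, 2), (2, 0), (1, 2), (2, 1)}"

lemma R3_pos_bounds: "e \<in> {1, -1} \<Longrightarrow> R3_pos e i j \<in> {-1<..<1}"
  using slide_pos_pos slide_pos_less by (auto simp: R3_pos_def)

lemma tangle_crossings_R3:
  assumes e: "e \<in> {1, -1}"
  shows "tangle_crossings (R3_tangle e) = R3_crossing e ` R3_strands" (is "_ = ?X")
proof -
  define S0 S1 S2 where "S0 = R3_tangle e ! 0" and "S1 = R3_tangle e ! Suc 0" and "S2 = R3_tangle e ! 2"
  have S00: "S0 u = S0 v \<longleftrightarrow> u = v" and S11: "S1 u = S1 v \<longleftrightarrow> u = v" and S22: "S2 u = S2 v \<longleftrightarrow> u = v" for u v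
    by (auto simp: S0_def S1_def S2_def R3_tangle_def)
  have S01: "S0 u = S1 v \<longleftrightarrow> u = 0 \<and> v = 0" and S10: "S1 v = S0 u \<longleftrightarrow> u = 0 \<and> v = 0" for u v
    by (auto simp: S0_def S1_def R3_tangle_def)
  have ee: "e * e = 1" "e = 1 \<or> e = -1" using e by auto
  have bd: "- 1 \<le> 5/4 * (e * slide_pos)" "5/4 * (e * slide_pos) \<le> 1" "- 1 \<le> e * slide_pos" "e * slide_pos \<le> 1"
    using ee(2) slide_pos_pos slide_pos_less by auto
  have "S0 u = S2 v \<longleftrightarrow> u = 5/4 * (e * slide_pos) \<and> v = e * slide_pos" if "v \<in> {-1..1}" for u v
  proof -
    have "S0 u = S2 v \<longleftrightarrow> u = 5/4 * v \<and> 3/4 * v = e * (1 - v\<^sup>2)\<^sup>2"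
      unfolding S0_def S2_def R3_tangle_def by (auto simp: field_simps)
    \<comment> \<open>Both positions of strand 2 lead to the equation of \<open>slide_pos\<close>,
      by inserting \<open>e * v\<close> here and \<open>- e * v\<close> for the falling strand
      1.\<close>
    also have "3/4 * v = e * (1 - v\<^sup>2)\<^sup>2 \<longleftrightarrow> (1 - (e * v)\<^sup>2)\<^sup>2 = 3/4 * (e * v)" using ee(2) by auto
    also have "\<dots> \<longleftrightarrow> e * v = slide_pos" by (rule slide_pos_iff) (use ee(2) that in auto)
    also have "\<dots> \<longleftrightarrow> v = e * slide_pos" using ee(2) by auto
    finally show ?thesis by auto
  qed
  then have S02: "u \<in> {-1..1} \<and> v \<in> {-1..1} \<and> S0 u = S2 v \<longleftrightarrow> u = 5/4 * (e * slide_pos) \<and> v = e * slide_pos" for u v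
    using bd by fastforce
  have "S1 u = S2 v \<longleftrightarrow> u = - 5/4 * (e * slide_pos) \<and> v = - (e * slide_pos)" if "v \<in> {-1..1}" for u v
  proof -
    have "S1 u = S2 v \<longleftrightarrow> u = 5/4 * v \<and> - 3/4 * v = e * (1 - v\<^sup>2)\<^sup>2"
      unfolding S1_def S2_def R3_tangle_def by (auto simp: field_simps)
    also have "- 3/4 * v = e * (1 - v\<^sup>2)\<^sup>2 \<longleftrightarrow> (1 - (- e * v)\<^sup>2)\<^sup>2 = 3/4 * (- e * v)" using ee(2) by auto
    also have "\<dots> \<longleftrightarrow> - e * v = slide_pos" by (rule slide_pos_iff) (use ee(2) that in auto)
    also have "\<dots> \<longleftrightarrow> v = - (e * slide_pos)" using ee(2) by auto
    finally show ?thesis by auto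
  qed
  then have S12: "u \<in> {-1..1} \<and> v \<in> {-1..1} \<and> S1 u = S2 v \<longleftrightarrow> u = - 5/4 * (e * slide_pos) \<and> v = - (e * slide_pos)" for u v
    using bd by fastforce
  have S20: "v \<in> {-1..1} \<and> u \<in> {-1..1} \<and> S2 v = S0 u \<longleftrightarrow> u = 5/4 * (e * slide_pos) \<and> v = e * slide_pos" for u v
    using S02[of u v] by (simp only: conj_commute[of "v \<in> _"] conj_assoc eq_commute[of "S2 v"])
  have S21: "v \<in> {-1..1} \<and> u \<in> {-1..1} \<and> S2 v = S1 u \<longleftrightarrow> u = - 5/4 * (e * slide_pos) \<and> v = - (e * slide_pos)" for u v
    using S12[of u v] by (simp only: conj_commute[of "v \<in> _"] conj_assoc eq_commute[of "S2 v"])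
  have len: "length (R3_tangle e) = 3" by (simp add: R3_tangle_def)
  have X: "?X = {((0, 0), (1, 0)), ((1, 0), (0, 0)),
      ((0, 5/4 * (e * slide_pos)), (2, e * slide_pos)), ((2, e * slide_pos), (0, 5/4 * (e * slide_pos))),
      ((1, - 5/4 * (e * slide_pos)), (2, - (e * slide_pos))), ((2, - (e * slide_pos)), (1, - 5/4 * (e * slide_pos)))}"
    by (simp add: R3_crossing_def R3_pos_def)
  have "((i, u), (j, v)) \<in> ?X" if ij: "((i, u), (j, v)) \<in> tangle_crossings (R3_tangle e)" for i u j v
  proof -
    have uv: "(i, u) \<noteq> (j, v)" "u \<in> {-1..1} \<and> v \<in> {-1..1} \<and> (R3_tangle e ! i) u = (R3_tangle e ! j) v"
      and "i < 3" "j < 3"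
      using ij unfolding tangle_crossings_iff len by blast+
    then have "i = 0 \<or> i = Suc 0 \<or> i = 2" "j = 0 \<or> j = Suc 0 \<or> j = 2" by linarith+
    then consider "i = 0" "j = 0" | "i = 0" "j = Suc 0" | "i = 0" "j = 2"
      | "i = Suc 0" "j = 0" | "i = Suc 0" "j = Suc 0" | "i = Suc 0" "j = 2"
      | "i = 2" "j = 0" | "i = 2" "j = Suc 0" | "i = 2" "j = 2" by blast
    then show ?thesis
    proof cases
      case 1 with uv S00 show ?thesis by (simp add: S0_def)
    next
      case 2 with uv S01 show ?thesis unfolding X by (simp add: S0_def S1_def)
    next
      case 3 with uv S02[of u v] show ?thesis unfolding X by (simp add: S0_def S2_def del: atLeastAtMost_iff)
    next
      case 4 with uv S10 show ?thesis unfolding X by (simp add: S0_def S1_def)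
    next
      case 5 with uv S11 show ?thesis by (simp add: S1_def)
    next
      case 6 with uv S12[of u v] show ?thesis unfolding X by (simp add: S1_def S2_def del: atLeastAtMost_iff)
    next
      case 7 with uv S20[of u v] show ?thesis unfolding X by (simp add: S0_def S2_def del: atLeastAtMost_iff)
    next
      case 8 with uv S21[of u v] show ?thesis unfolding X by (simp add: S1_def S2_def del: atLeastAtMost_iff)
    next
      case 9 with uv S22 show ?thesis by (simp add: S2_def)
    qed
  qed
  moreover have "?X \<subseteq> tangle_crossings (R3_tangle e)"
    using S01[of 0 0] S10[of 0 0] S02[of "5/4 * (e * slide_pos)" "e * slide_pos"]
      S20[of "e * slide_pos" "5/4 * (e * slide_pos)"] S12[of "- 5/4 * (e * slide_pos)" "- (e * slide_pos)"]
      S21[of "- (e * slide_pos)" "- 5/4 * (e * slide_pos)"]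
    unfolding X insert_subset tangle_crossings_iff len
    by (simp add: S0_def S1_def S2_def)
  ultimately show ?thesis by (rule equalityI[OF subset_pairsI])
qed

section \<open>Sliding a strand across a crossing\<close>

definition R3_velocity :: "real \<Rightarrow> nat \<Rightarrow> real \<Rightarrow> complex" where
  "R3_velocity e i u =
     (if i = 0 then Complex (4/5) (3/5) else if i = 1 then Complex (4/5) (- 3/5)
      else Complex 1 (- 4 * e * u * (1 - u\<^sup>2)))"

lemma R3_has_velocity:
  assumes "i < 3"
  shows "((R3_tangle e ! i) has_vector_derivative R3_velocity e i u) (at u)"
proof -
  consider "i = 0" | "i = 1" | "i = 2" using assms by linarith
  then show ?thesis
  proof cases
    case 1
    have "((\<lambda>u. Complex (4/5 * u) (3/5 * u)) has_vector_derivative Complex (4/5) (3/5)) (at u)"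
      by (rule has_vector_derivative_Complex) (auto intro!: derivative_eq_intros)
    then show ?thesis using 1 by (simp only: R3_tangle_def R3_velocity_def nth_Cons_0 simp_thms if_True)
  next
    case 2
    have "((\<lambda>u. Complex (4/5 * u) (- 3/5 * u)) has_vector_derivative Complex (4/5) (- 3/5)) (at u)"
      by (rule has_vector_derivative_Complex) (auto intro!: derivative_eq_intros)
    then show ?thesis using 2 by (simp add: R3_tangle_def R3_velocity_def)
  next
    case 3
    have "((\<lambda>u. e * (1 - u\<^sup>2)\<^sup>2) has_real_derivative - 4 * e * u * (1 - u\<^sup>2)) (at u)"
      by (auto intro!: derivative_eq_intros simp: algebra_simps)
    then have "((\<lambda>u. Complex u (e * (1 - u\<^sup>2)\<^sup>2)) has_vector_derivative Complex 1 (- 4 * e * u * (1 - u\<^sup>2))) (at u)"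
      by (intro has_vector_derivative_Complex DERIV_ident)
    then show ?thesis using 3 by (simp add: R3_tangle_def R3_velocity_def)
  qed
qed

lemma R3_velocity_sign:
  assumes e: "e \<in> {1, -1}" and ij: "(i, j) \<in> R3_strands"
  shows "sgn (Im (cnj (R3_velocity e i (R3_pos e i j)) * R3_velocity e j (R3_pos e j i))) = R3_sign i j"
proof -
  \<comment> \<open>Strand 2 has the slope \<open>- 4 * q\<close> where it meets strand 0 and
    \<open>4 * q\<close> where it meets strand 1. The two factors \<open>e\<close> cancel, so the
    slopes are the same on both sides of the move.\<close>
  define q where "q = slide_pos * (1 - slide_pos\<^sup>2)"
  have "slide_pos\<^sup>2 < 1" using slide_pos_pos slide_pos_less by (simp add: abs_square_less_1)
  then have q: "q > 0" using slide_pos_pos by (simp add: q_def)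
  have e2: "e\<^sup>2 = 1" "e * e = 1" using e by auto
  have slope: "- 4 * e * (e * slide_pos) * (1 - (e * slide_pos)\<^sup>2) = - 4 * q"
    "- 4 * e * (- (e * slide_pos)) * (1 - (- (e * slide_pos))\<^sup>2) = 4 * q"
    using e by (auto simp: q_def)
  have v: "R3_velocity e 2 (e * slide_pos) = Complex 1 (- 4 * q)"
    "R3_velocity e 2 (- (e * slide_pos)) = Complex 1 (4 * q)"
    "R3_velocity e 0 u = Complex (4/5) (3/5)" "R3_velocity e 1 u = Complex (4/5) (- 3/5)" for u
    using slope by (simp_all add: R3_velocity_def)
  from ij consider "i = 0 \<and> j = 1" | "i = 1 \<and> j = 0" | "i = 0 \<and> j = 2" | "i = 2 \<and> j = 0"
    | "i = 1 \<and> j = 2" | "i = 2 \<and> j = 1" by auto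
  then show ?thesis
    by cases (simp_all add: R3_pos_def R3_sign_def v q sgn_if del: One_nat_def, (use q in linarith)+)
qed

text \<open>In all three moves of this shape the mark depends only on the two strands and is the
  same before and after. So \<open>M\<close> does not involve \<open>e\<close>, and the side of the
  move shows only in the positions \<open>R3_pos e\<close>.\<close>

locale embedded_R3 = embedded_tangle "R3_tangle e" c r D for e c r D +
  fixes M :: "nat \<Rightarrow> nat \<Rightarrow> passage"
  assumes e: "e \<in> {1, -1}"
    and R3_marked: "marked (R3_tangle e) c r (\<lambda>i u j v. M i j) D"
begin

lemma length_R3: "length (R3_tangle e) = 3"
  by (simp add: R3_tangle_def)

lemma mark_R3: "(i, j) \<in> R3_strands \<Longrightarrow> mark D (c i + r i * R3_pos e i j) = M i j"
  by (rule marked_crossing[OF R3_marked, of i "R3_pos e i j" j "R3_pos e j i"])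
    (unfold tangle_crossings_R3[OF e], rule image_eqI[of _ _ "(i, j)"], auto simp: R3_crossing_def)

lemma vsign_R3:
  assumes "(i, j) \<in> R3_strands"
  shows "vsign D a (c i + r i * R3_pos e i j) (c j + r j * R3_pos e j i) =
    (if M i j = Virt a then sgn (r i) * sgn (r j) * R3_sign i j else 0)"
proof -
  have "i < 3" "j < 3" using assms by auto
  then have "vsign D a (c i + r i * R3_pos e i j) (c j + r j * R3_pos e j i) =
    (if mark D (c i + r i * R3_pos e i j) = Virt a then sgn (r i) * sgn (r j) *
      sgn (Im (cnj (R3_velocity e i (R3_pos e i j)) * R3_velocity e j (R3_pos e j i))) else 0)"
    by (intro vsign_strands[OF _ R3_pos_bounds[OF e] R3_has_velocity _ R3_pos_bounds[OF e] R3_has_velocity refl])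
      (simp_all add: length_R3)
  then show ?thesis unfolding R3_velocity_sign[OF e assms] mark_R3[OF assms] .
qed

lemma inner_index_R3:
  "inner_index (R3_tangle e) c r D a s t =
    (\<Sum>(i, j)\<in>R3_strands. (if M i j = Virt a then sgn (r i) * sgn (r j) * R3_sign i j else 0) *
       of_int (\<lfloor>t - (c i + r i * R3_pos e i j)\<rfloor> - \<lfloor>s - (c i + r i * R3_pos e i j)\<rfloor>))"
proof -
  have inj: "inj_on (R3_crossing e) R3_strands" by (rule inj_onI) (auto simp: R3_crossing_def)
  show ?thesis
    unfolding inner_index_def tangle_crossings_R3[OF e] sum.reindex[OF inj] o_def
  proof (rule sum.cong[OF refl])
    fix p assume p: "p \<in> R3_strands"
    obtain i j where ij: "p = (i, j)" by (cases p)
    show "(case R3_crossing e p of (x, y) \<Rightarrow> vsign D a (param c r x) (param c r y)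
        * real_of_int (\<lfloor>t - param c r x\<rfloor> - \<lfloor>s - param c r x\<rfloor>))
      = (case p of (i, j) \<Rightarrow> (if M i j = Virt a then sgn (r i) * sgn (r j) * R3_sign i j else 0) *
       of_int (\<lfloor>t - (c i + r i * R3_pos e i j)\<rfloor> - \<lfloor>s - (c i + r i * R3_pos e i j)\<rfloor>))"
      unfolding ij R3_crossing_def case_prod_conv param_simp vsign_R3[OF p[unfolded ij]] ..
  qed
qed

text \<open>For endpoints off the strands the positions drop out, and \<open>e\<close> with them.
  This settles the indices of all outside crossings for the three moves at once.\<close>

lemma inner_index_R3_off:
  assumes "\<And>i. i < 3 \<Longrightarrow> off_strand c r i s" "\<And>i. i < 3 \<Longrightarrow> off_strand c r i t"
  shows "inner_index (R3_tangle e) c r D a s t =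
    (\<Sum>(i, j)\<in>R3_strands. (if M i j = Virt a then sgn (r i) * sgn (r j) * R3_sign i j else 0) *
       of_int (\<lfloor>t - c i\<rfloor> - \<lfloor>s - c i\<rfloor>))"
  unfolding inner_index_R3
proof (rule sum.cong[OF refl])
  fix p assume p: "p \<in> R3_strands"
  obtain i j where ij: "p = (i, j)" by (cases p)
  then have "i < 3" using p by auto
  moreover have "R3_pos e i j \<in> {-1..1}" using R3_pos_bounds[OF e, of i j] by simp
  ultimately have "\<lfloor>t - (c i + r i * R3_pos e i j)\<rfloor> = \<lfloor>t - c i\<rfloor>" "\<lfloor>s - (c i + r i * R3_pos e i j)\<rfloor> = \<lfloor>s - c i\<rfloor>"
    using floor_off_strand assms by blast+
  then show "(case p of (i, j) \<Rightarrow> (if M i j = Virt a then sgn (r i) * sgn (r j) * R3_sign i j else 0) *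
       real_of_int (\<lfloor>t - (c i + r i * R3_pos e i j)\<rfloor> - \<lfloor>s - (c i + r i * R3_pos e i j)\<rfloor>))
    = (case p of (i, j) \<Rightarrow> (if M i j = Virt a then sgn (r i) * sgn (r j) * R3_sign i j else 0) *
       of_int (\<lfloor>t - c i\<rfloor> - \<lfloor>s - c i\<rfloor>))"
    by (simp add: ij)
qed

text \<open>Since a move preserves \<open>outer_index\<close>, the counts on its two sides, written
  in terms of strand pairs, can differ only through \<open>inner_index\<close>.\<close>

lemma card_inner_indexed_R3:
  "card (inner_indexed (R3_tangle e) c r D f) =
    card {(i, j) \<in> R3_strands. M i j = Over \<and>
      (\<forall>a. outer_index D a (c i) (c j) + inner_index (R3_tangle e) c r D a
         (c i + r i * R3_pos e i j) (c j + r j * R3_pos e j i) = f a)}" (is "_ = card ?S")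
proof -
  have mem: "R3_crossing e p \<in> inner_indexed (R3_tangle e) c r D f \<longleftrightarrow> p \<in> ?S" if p: "p \<in> R3_strands" for p
  proof -
    obtain i j where ij: "p = (i, j)" by (cases p)
    have lt: "i < 3" "j < 3" using p ij by auto
    have pos: "R3_pos e i j \<in> {-1..1}" "R3_pos e j i \<in> {-1..1}"
      using R3_pos_bounds[OF e, of i j] R3_pos_bounds[OF e, of j i] by simp_all
    have "R3_crossing e p \<in> tangle_crossings (R3_tangle e)"
      unfolding tangle_crossings_R3[OF e] using p by (rule imageI)
    then show ?thesis
      using p mark_R3[OF p[unfolded ij]] outer_index_strands[of i "R3_pos e i j" j "R3_pos e j i"] lt pos
      unfolding length_R3 ij
      by (simp add: inner_indexed_def R3_crossing_def vindex_split del: insert_iff)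
  qed
  have "inner_indexed (R3_tangle e) c r D f = R3_crossing e ` ?S"
  proof (intro equalityI subsetI)
    fix x assume x: "x \<in> inner_indexed (R3_tangle e) c r D f"
    then have "x \<in> R3_crossing e ` R3_strands"
      unfolding tangle_crossings_R3[OF e, symmetric] by (cases x) (simp add: inner_indexed_def)
    then obtain p where p: "x = R3_crossing e p" "p \<in> R3_strands" by (rule imageE)
    have "p \<in> ?S" using x unfolding p(1) mem[OF p(2)] .
    with p(1) show "x \<in> R3_crossing e ` ?S" by (rule image_eqI)
  next
    fix x assume "x \<in> R3_crossing e ` ?S"
    then obtain p where p: "x = R3_crossing e p" "p \<in> ?S" by (rule imageE)
    have "p \<in> R3_strands" using p(2) by (cases p) (simp only: mem_Collect_eq case_prod_conv)
    from mem[OF this] show "x \<in> inner_indexed (R3_tangle e) c r D f" using p by simp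
  qed
  moreover have "inj_on (R3_crossing e) ?S" by (rule inj_onI) (auto simp: R3_crossing_def)
  ultimately show ?thesis by (simp add: card_image)
qed

end

text \<open>The crossings of the two triangles correspond to each other, so even their numbers
  agree. The hypothesis \<open>over\<close> leaves to each move the part of the index that comes
  from the triangle itself.\<close>

lemma parity_R3:
  assumes R: "replaces (R3_tangle 1) (R3_tangle (-1)) c r D D'"
    and M: "marked (R3_tangle 1) c r (\<lambda>i u j v. M i j) D" "marked (R3_tangle (-1)) c r (\<lambda>i u j v. M i j) D'"
    and over: "\<And>i j a. (i, j) \<in> R3_strands \<Longrightarrow> M i j = Over \<Longrightarrow>
      embedded_R3 1 c r D M \<Longrightarrow> embedded_R3 (-1) c r D' M \<Longrightarrow>
      inner_index (R3_tangle 1) c r D a (c i + r i * R3_pos 1 i j) (c j + r j * R3_pos 1 j i) =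
      inner_index (R3_tangle (-1)) c r D' a (c i + r i * R3_pos (-1) i j) (c j + r j * R3_pos (-1) j i)"
  shows "even (card (indexed_crossings D f)) = even (card (indexed_crossings D' f))"
proof (rule parity_replaced[OF R])
  show disc: "in_disc (R3_tangle 1)" "in_disc (R3_tangle (-1))" by (simp_all add: in_disc_R3)
  note emb = replaces_embedded(1,2)[OF R disc]
  have R3: "embedded_R3 1 c r D M" "embedded_R3 (-1) c r D' M"
    using emb M by (simp_all add: embedded_R3_def embedded_R3_axioms_def)
  interpret D: embedded_R3 1 c r D M by (rule R3)
  interpret D': embedded_R3 "-1" c r D' M by (rule R3)
  show "inner_index (R3_tangle 1) c r D a s t = inner_index (R3_tangle (-1)) c r D' a s t"
    if "\<not> on_strands c r (length (R3_tangle 1)) s" "\<not> on_strands c r (length (R3_tangle 1)) t" for a s t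
  proof -
    have "off_strand c r i s" "off_strand c r i t" if "i < 3" for i
      using that off_strand_outside \<open>\<not> on_strands c r _ s\<close> \<open>\<not> on_strands c r _ t\<close> by (auto simp: D.length_R3)
    then show ?thesis by (simp only: D.inner_index_R3_off D'.inner_index_R3_off)
  qed
  have "card (inner_indexed (R3_tangle 1) c r D f) = card (inner_indexed (R3_tangle (-1)) c r D' f)"
    unfolding D.card_inner_indexed_R3 D'.card_inner_indexed_R3 outer_replaced(2)[OF R disc]
    by (rule arg_cong[where f = card], rule Collect_cong) (use over[OF _ _ R3] in fastforce)
  then show "even (card (inner_indexed (R3_tangle 1) c r D f)) = even (card (inner_indexed (R3_tangle (-1)) c r D' f))"
    by simp
qed

text \<open>A slide replaces the displacement \<open>z\<close> of a virtual passage from an endpoint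
  on the same strand by \<open>- z\<close>; this is the resulting jump of the floor.\<close>

lemma floor_minus_diff:
  fixes z :: real
  assumes "z \<noteq> 0" "\<bar>z\<bar> < 1"
  shows "of_int (\<lfloor>- z\<rfloor> - \<lfloor>z\<rfloor>) = - sgn z"
proof (cases "z > 0")
  case True
  then have "\<lfloor>z\<rfloor> = 0" "\<lfloor>- z\<rfloor> = - 1" using assms by (auto simp: floor_eq_iff)
  then show ?thesis using True by simp
next
  case False
  then have "\<lfloor>z\<rfloor> = - 1" "\<lfloor>- z\<rfloor> = 0" using assms by (auto simp: floor_eq_iff)
  then show ?thesis using False assms by (simp add: sgn_if)
qed

text \<open>Otherwise the strand parameters \<open>1 / (2 * r i)\<close> and
  \<open>- (1 / (2 * r i))\<close> would be admissible and a full turn apart, which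
  \<open>disjoint\<close> forbids.\<close>

lemma (in embedded_tangle) half_width:
  assumes "i < length T"
  shows "\<bar>r i\<bar> < 1/2"
proof (rule ccontr)
  assume "\<not> \<bar>r i\<bar> < 1/2"
  then have "\<bar>1 / (2 * r i)\<bar> \<le> 1" by (simp add: abs_mult field_simps)
  then have "1 / (2 * r i) \<in> {-1..1}" "- (1 / (2 * r i)) \<in> {-1..1}"
    unfolding atLeastAtMost_iff by linarith+
  moreover have "(c i + r i * (1 / (2 * r i))) - (c i + r i * (- (1 / (2 * r i)))) = 1"
    using r_nonzero[OF assms] by simp
  ultimately have "1 / (2 * r i) = - (1 / (2 * r i))"
    using disjoint[OF assms assms] by (metis Ints_1)
  then show False using r_nonzero[OF assms] by simp
qed

text \<open>
  At the moment when strand 2 slides across the classical crossing, strand 0 loses a passage through a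
  virtual crossing and strand 1 gains one, or vice versa; in the index of the classical crossing the
  two changes cancel.
\<close>

lemma inner_index_Omega3cv:
  assumes D: "embedded_R3 1 c r D M" and D': "embedded_R3 (-1) c r D' M"
    and M: "\<And>b. M 0 1 \<noteq> Virt b" "\<And>b. M 1 0 \<noteq> Virt b" "M 0 2 = Virt a" "M 2 0 = Virt a" "M 1 2 = Virt a" "M 2 1 = Virt a"
  shows "inner_index (R3_tangle 1) c r D b (c 0) (c 1) = inner_index (R3_tangle (-1)) c r D' b (c 0) (c 1)"
proof -
  interpret D: embedded_R3 1 c r D M by (rule D)
  interpret D': embedded_R3 "-1" c r D' M by (rule D')
  let ?p = "5/4 * slide_pos"
  have len: "length (R3_tangle 1) = 3" by (rule D.length_R3)
  have off: "off_strand c r j (c i)" if "i < 3" "j < 3" "i \<noteq> j" for i j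
    using D.off_strand_other[of i j 0] that by (simp add: len)
  have p: "?p \<in> {-1..1}" "- ?p \<in> {-1..1}" "slide_pos \<in> {-1..1}" "- slide_pos \<in> {-1..1}"
    using slide_pos_pos slide_pos_less by auto
  \<comment> \<open>\<open>r i * ?p\<close> is, up to sign, the displacement between the virtual and
    the classical passage on strand \<open>i\<close>; \<open>half_width\<close> keeps it below a
    full turn.\<close>
  have z: "of_int (\<lfloor>- (r i * ?p)\<rfloor> - \<lfloor>r i * ?p\<rfloor>) = - sgn (r i)" if "i < 3" for i
  proof -
    have "\<bar>r i\<bar> * \<bar>?p\<bar> \<le> 1/2 * 1"
      using D.half_width[of i] that slide_pos_pos slide_pos_less by (intro mult_mono) (auto simp: len)
    then have "\<bar>r i * ?p\<bar> < 1" unfolding abs_mult by linarith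
    then have "of_int (\<lfloor>- (r i * ?p)\<rfloor> - \<lfloor>r i * ?p\<rfloor>) = - sgn (r i * ?p)"
      using D.r_nonzero[of i] that slide_pos_pos
      by (intro floor_minus_diff) (auto simp: len)
    then show ?thesis using slide_pos_pos by (simp add: sgn_mult)
  qed
  have off_floor: "\<lfloor>c i - (c j + r j * u)\<rfloor> = \<lfloor>c i - c j\<rfloor>" if "i < 3" "j < 3" "i \<noteq> j" "u \<in> {-1..1}" for i j u
    using floor_off_strand[OF off] that by blast
  \<comment> \<open>Both sides of the move at once. Only the floors of
    \<open>- (r 0 * (e * ?p))\<close> and \<open>r 1 * (e * ?p)\<close> depend on \<open>e\<close>;
    after multiplication by \<open>sgn (r 0)\<close> and \<open>sgn (r 1)\<close> they change by
    opposite amounts, whatever the orientations.\<close>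
  have "inner_index (R3_tangle e) c r X b (c 0) (c 1) = (if a = b then
      sgn (r 2) * (- sgn (r 0) * (\<lfloor>c 1 - c 0\<rfloor> - \<lfloor>- (r 0 * (e * ?p))\<rfloor>) + sgn (r 1) * (\<lfloor>r 1 * (e * ?p)\<rfloor> - \<lfloor>c 0 - c 1\<rfloor>)
        + (sgn (r 0) - sgn (r 1)) * (\<lfloor>c 1 - c 2\<rfloor> - \<lfloor>c 0 - c 2\<rfloor>)) else 0)"
    if "embedded_R3 e c r X M" for e X
  proof -
    interpret X: embedded_R3 e c r X M by (rule that)
    have e: "e = 1 \<or> e = - 1" using X.e by simp
    have 0: "\<lfloor>c 1 - (c 0 + r 0 * R3_pos e 0 2)\<rfloor> = \<lfloor>c 1 - c 0\<rfloor>"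
      "\<lfloor>c 0 - (c 1 + r 1 * R3_pos e 1 2)\<rfloor> = \<lfloor>c 0 - c 1\<rfloor>"
      "\<lfloor>c 1 - (c 2 + r 2 * R3_pos e 2 j)\<rfloor> = \<lfloor>c 1 - c 2\<rfloor>"
      "\<lfloor>c 0 - (c 2 + r 2 * R3_pos e 2 j)\<rfloor> = \<lfloor>c 0 - c 2\<rfloor>" for j
      using R3_pos_bounds[OF X.e, of 0 2] R3_pos_bounds[OF X.e, of 1 2] R3_pos_bounds[OF X.e, of 2 j]
      by (intro off_floor; simp)+
    have 1: "R3_pos e 0 2 = e * ?p" "R3_pos e 1 2 = - (e * ?p)"
      by (simp_all add: R3_pos_def)
    have "R3_sign 0 2 = - 1" "R3_sign 2 0 = 1" "R3_sign 1 2 = 1" "R3_sign 2 1 = - 1"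
      by (simp_all add: R3_sign_def)
    then show ?thesis
      unfolding X.inner_index_R3
      by (simp add: 0 M del: One_nat_def) (simp add: 1 algebra_simps del: One_nat_def)
  qed
  from this[OF D] this[OF D'] show ?thesis
    using z[of 0] z[of 1] D.r_nonzero[of 0] D.r_nonzero[of 1] D.r_nonzero[of 2]
    by (auto simp: len sgn_if split: if_splits)
qed

section \<open>Parity under the Reidemeister moves\<close>

lemma inner_no_crossings:
  assumes "tangle_crossings T = {}"
  shows "inner_index T c r D a s t = 0" "inner_indexed T c r D f = {}"
  using assms by (simp_all add: inner_index_def inner_indexed_def)

lemma marked_mark:
  assumes "marked T c r L D" "(x, y) \<in> tangle_crossings T"
  shows "mark D (param c r x) = L (fst x) (snd x) (fst y) (snd y)"
  using marked_crossing[OF assms(1), of "fst x" "snd x" "fst y" "snd y"] assms(2) by (simp add: param_def case_prod_unfold)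

lemma parity_Omega1:
  assumes R: "replaces R1_plain R1_kink c r D D'" and pq: "(p, q) \<in> {(Over, Under), (Under, Over)}"
    and M: "marked R1_kink c r (\<lambda>i u j v. if u < v then p else q) D'"
    and f: "f a \<noteq> 0"
  shows "even (card (indexed_crossings D f)) = even (card (indexed_crossings D' f))"
proof (rule parity_replaced[OF R in_disc_R1_plain in_disc_R1_kink])
  interpret D': embedded_tangle R1_kink c r D'
    by (rule replaces_embedded[OF R in_disc_R1_plain in_disc_R1_kink])
  have len: "length R1_kink = 1" by (simp add: R1_kink_def)
  have inner: "inner_index R1_kink c r D' b s t = 0" for b s t
    by (rule inner_index_eq_0) (use pq in \<open>auto simp: marked_mark[OF M]\<close>)
  show "inner_index R1_plain c r D b s t = inner_index R1_kink c r D' b s t" for b s t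
    by (simp add: inner inner_no_crossings[OF tangle_crossings_R1_plain])
  \<comment> \<open>Both passages are on one strand, so the outer part vanishes too: the new
    crossing has index 0 and is not counted, as \<open>f a \<noteq> 0\<close>.\<close>
  have "vindex D' a (param c r (0, u)) (param c r (0, v)) = 0" if "u \<in> {-1..1}" "v \<in> {-1..1}" for u v
    using D'.outer_index_strands[of 0 u 0 v a] that
    by (simp add: D'.vindex_split inner outer_index_same len)
  then have ind: "vindex D' a (param c r x) (param c r y) = 0" if "(x, y) \<in> tangle_crossings R1_kink" for x y
    using that kink_pos_bounds unfolding tangle_crossings_R1_kink by (auto simp del: param_simp)
  have "(x, y) \<notin> inner_indexed R1_kink c r D' f" for x y
  proof
    assume "(x, y) \<in> inner_indexed R1_kink c r D' f"
    then have "(x, y) \<in> tangle_crossings R1_kink" "vindex D' a (param c r x) (param c r y) = f a"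
      by (simp_all add: inner_indexed_def)
    then show False using ind f by simp
  qed
  then have "inner_indexed R1_kink c r D' f = {}" by auto
  then show "even (card (inner_indexed R1_plain c r D f)) = even (card (inner_indexed R1_kink c r D' f))"
    by (simp add: inner_no_crossings[OF tangle_crossings_R1_plain])
qed

text \<open>Seen from off the strand, both passages through the kink count as if at its centre,
  where their opposite signs cancel.\<close>

lemma parity_Omega1v:
  assumes R: "replaces R1_plain R1_kink c r D D'"
    and M: "marked R1_kink c r (\<lambda>i u j v. Virt a) D'"
  shows "even (card (indexed_crossings D f)) = even (card (indexed_crossings D' f))"
proof (rule parity_replaced[OF R in_disc_R1_plain in_disc_R1_kink])
  interpret D': embedded_tangle R1_kink c r D'
    by (rule replaces_embedded[OF R in_disc_R1_plain in_disc_R1_kink])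
  let ?k = "c 0 + r 0 * kink_pos" and ?l = "c 0 + r 0 * (- kink_pos)"
  have "inner_indexed R1_kink c r D' f = {}"
    by (rule inner_indexed_eq_empty) (simp add: marked_mark[OF M])
  then show "even (card (inner_indexed R1_plain c r D f)) = even (card (inner_indexed R1_kink c r D' f))"
    by (simp add: inner_no_crossings[OF tangle_crossings_R1_plain])
  fix b s t
  assume "\<not> on_strands c r (length R1_plain) s" "\<not> on_strands c r (length R1_plain) t"
  then have off: "off_strand c r 0 s" "off_strand c r 0 t"
    by (auto intro: off_strand_outside simp: R1_plain_def)
  have "mark D' ?k = Virt a" "mark D' ?l = Virt a"
    using marked_crossing[OF M] tangle_crossings_R1_kink by blast+
  moreover have "Im (cnj (velocity D' ?l) * velocity D' ?k) = - Im (cnj (velocity D' ?k) * velocity D' ?l)"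
    by simp
  ultimately have "vsign D' b ?l ?k = - vsign D' b ?k ?l"
    by (simp only: vsign_def sgn_minus) simp
  moreover have "inner_index R1_kink c r D' b s t = (vsign D' b ?k ?l + vsign D' b ?l ?k) * (\<lfloor>t - c 0\<rfloor> - \<lfloor>s - c 0\<rfloor>)"
    unfolding inner_index_def tangle_crossings_R1_kink
    using kink_pos_bounds floor_off_strand[OF off(1), of kink_pos] floor_off_strand[OF off(1), of "- kink_pos"]
      floor_off_strand[OF off(2), of kink_pos] floor_off_strand[OF off(2), of "- kink_pos"]
    by (simp add: algebra_simps)
  ultimately show "inner_index R1_plain c r D b s t = inner_index R1_kink c r D' b s t"
    by (simp add: inner_no_crossings[OF tangle_crossings_R1_plain])
qed

lemma parity_Omega2:
  assumes R: "replaces R2_plain R2_bigon c r D D'" and k: "k \<in> {0, 1}"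
    and M: "marked R2_bigon c r (\<lambda>i u j v. if i = k then Over else Under) D'"
  shows "even (card (indexed_crossings D f)) = even (card (indexed_crossings D' f))"
proof (rule parity_replaced[OF R in_disc_R2_plain in_disc_R2_bigon])
  interpret D': embedded_tangle R2_bigon c r D'
    by (rule replaces_embedded[OF R in_disc_R2_plain in_disc_R2_bigon])
  have inner: "inner_index R2_bigon c r D' b s t = 0" for b s t
    by (rule inner_index_eq_0) (auto simp: marked_mark[OF M])
  show "inner_index R2_plain c r D b s t = inner_index R2_bigon c r D' b s t" for b s t
    by (simp add: inner inner_no_crossings[OF tangle_crossings_R2_plain])
  let ?l = "1 - k"
  \<comment> \<open>Both new crossings have the over-passage on strand \<open>k\<close> and the
    under-passage on the other strand, hence the same index; \<open>P\<close> decides whether both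
    are counted or none.\<close>
  define P where "P \<longleftrightarrow> (\<forall>a. outer_index D' a (c k) (c ?l) = f a)"
  have "(x, y) \<in> inner_indexed R2_bigon c r D' f \<longleftrightarrow> (x, y) \<in> tangle_crossings R2_bigon \<and> fst x = k \<and> P" for x y
  proof (cases "(x, y) \<in> tangle_crossings R2_bigon \<and> fst x = k")
    case True
    then have xy: "(x, y) \<in> tangle_crossings R2_bigon" and fx: "fst x = k" by auto
    have fy: "fst y = ?l" "fst x < length R2_bigon" "fst y < length R2_bigon" "snd x \<in> {-1..1}" "snd y \<in> {-1..1}"
      using xy fx kink_pos_bounds unfolding tangle_crossings_R2_bigon by (auto simp: R2_bigon_def)
    have "vindex D' a (param c r x) (param c r y) = outer_index D' a (c k) (c ?l)" for a
      using D'.outer_index_strands[OF fy(2,4,3,5)] fx fy(1)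
      by (simp add: D'.vindex_split inner param_def case_prod_unfold)
    moreover have "mark D' (param c r x) = Over" using marked_mark[OF M xy] fx by simp
    ultimately show ?thesis using xy fx by (simp add: inner_indexed_def P_def)
  next
    case False
    then show ?thesis using marked_mark[OF M, of x y] by (auto simp: inner_indexed_def split: if_splits)
  qed
  then have eq: "inner_indexed R2_bigon c r D' f = {(x, y) \<in> tangle_crossings R2_bigon. fst x = k \<and> P}"
    by auto
  have "{(x, y) \<in> tangle_crossings R2_bigon. fst x = k} =
    (if k = 0 then {((0, 4/5 * kink_pos), (1, kink_pos)), ((0, - 4/5 * kink_pos), (1, - kink_pos))}
     else {((1, kink_pos), (0, 4/5 * kink_pos)), ((1, - kink_pos), (0, - 4/5 * kink_pos))})"
    using k unfolding tangle_crossings_R2_bigon by auto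
  then have "card {(x, y) \<in> tangle_crossings R2_bigon. fst x = k} = 2"
    using kink_pos_bounds by simp
  then have "even (card (inner_indexed R2_bigon c r D' f))"
    unfolding eq by (cases P) auto
  then show "even (card (inner_indexed R2_plain c r D f)) = even (card (inner_indexed R2_bigon c r D' f))"
    by (simp add: inner_no_crossings[OF tangle_crossings_R2_plain])
qed

lemma R2_bigon_velocity:
  "((R2_bigon ! 0) has_vector_derivative Complex 1 0) (at u)"
  "((R2_bigon ! 1) has_vector_derivative Complex (4/5) (24/5 * u * (1 - u\<^sup>2))) (at u)"
proof -
  have "((\<lambda>u. Complex u 0) has_vector_derivative Complex 1 0) (at u)"
    by (rule has_vector_derivative_Complex) (auto intro!: derivative_eq_intros)
  then show "((R2_bigon ! 0) has_vector_derivative Complex 1 0) (at u)"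
    by (simp add: R2_bigon_def)
  have "((\<lambda>u. Complex (4/5 * u) (3/5 * (1 - 2 * (1 - u\<^sup>2)\<^sup>2))) has_vector_derivative Complex (4/5) (24/5 * u * (1 - u\<^sup>2))) (at u)"
    by (rule has_vector_derivative_Complex) (auto intro!: derivative_eq_intros simp: field_simps)
  then show "((R2_bigon ! 1) has_vector_derivative Complex (4/5) (24/5 * u * (1 - u\<^sup>2))) (at u)"
    by (simp add: R2_bigon_def)
qed

text \<open>In its own parametrization the curved strand goes down through the straight one and
  comes up again. So the two passages on each strand have opposite signs, and parameters off the
  strands see only their sum.\<close>

lemma parity_Omega2v:
  assumes R: "replaces R2_plain R2_bigon c r D D'"
    and M: "marked R2_bigon c r (\<lambda>i u j v. Virt a) D'"
  shows "even (card (indexed_crossings D f)) = even (card (indexed_crossings D' f))"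
proof (rule parity_replaced[OF R in_disc_R2_plain in_disc_R2_bigon])
  interpret D': embedded_tangle R2_bigon c r D'
    by (rule replaces_embedded[OF R in_disc_R2_plain in_disc_R2_bigon])
  have "inner_indexed R2_bigon c r D' f = {}"
    by (rule inner_indexed_eq_empty) (simp add: marked_mark[OF M])
  then show "even (card (inner_indexed R2_plain c r D f)) = even (card (inner_indexed R2_bigon c r D' f))"
    by (simp add: inner_no_crossings[OF tangle_crossings_R2_plain])
  fix b s t
  assume "\<not> on_strands c r (length R2_plain) s" "\<not> on_strands c r (length R2_plain) t"
  then have off: "off_strand c r i s" "off_strand c r i t" if "i < 2" for i
    using that by (auto intro!: off_strand_outside simp: R2_plain_def numeral_2_eq_2)
  \<comment> \<open>The factor common to both crossings; they differ in the sign of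
    \<open>u * (1 - u\<^sup>2)\<close> at \<open>u = kink_pos\<close> and
    \<open>u = - kink_pos\<close>.\<close>
  define w where "w = (if a = b then sgn (r 0) * sgn (r 1) else 0)"
  have "kink_pos * (1 - kink_pos\<^sup>2) > 0"
    using kink_pos_bounds by (simp add: abs_square_less_1)
  then have sgn_kink: "sgn (kink_pos * (1 - kink_pos\<^sup>2)) = 1" "sgn (- kink_pos * (1 - (- kink_pos)\<^sup>2)) = - 1"
    by (simp_all only: sgn_pos mult_minus_left sgn_minus power2_minus)
  have vs: "vsign D' b (c 0 + r 0 * (4/5 * u)) (c 1 + r 1 * u) = sgn (u * (1 - u\<^sup>2)) * w"
    "vsign D' b (c 1 + r 1 * u) (c 0 + r 0 * (4/5 * u)) = - sgn (u * (1 - u\<^sup>2)) * w"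
    if u: "u = kink_pos \<or> u = - kink_pos" for u
  proof -
    have cr: "((0, 4/5 * u), (1, u)) \<in> tangle_crossings R2_bigon" "((1, u), (0, 4/5 * u)) \<in> tangle_crossings R2_bigon"
      using u unfolding tangle_crossings_R2_bigon by auto
    have bd: "u \<in> {-1<..<1}" "4/5 * u \<in> {-1<..<1}" using u kink_pos_bounds by auto
    have len: "0 < length R2_bigon" "1 < length R2_bigon" by (simp_all add: R2_bigon_def)
    have sg: "sgn (24/5 * u * (1 - u\<^sup>2)) = sgn (u * (1 - u\<^sup>2))" "sgn (- (24/5 * u * (1 - u\<^sup>2))) = - sgn (u * (1 - u\<^sup>2))"
      by (simp_all add: sgn_mult)
    have "vsign D' b (c 0 + r 0 * (4/5 * u)) (c 1 + r 1 * u) =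
        (if mark D' (c 0 + r 0 * (4/5 * u)) = Virt b then sgn (r 0) * sgn (r 1) * sgn (24/5 * u * (1 - u\<^sup>2)) else 0)"
      by (rule D'.vsign_strands[OF len(1) bd(2) R2_bigon_velocity(1) len(2) bd(1) R2_bigon_velocity(2)]) simp
    then show "vsign D' b (c 0 + r 0 * (4/5 * u)) (c 1 + r 1 * u) = sgn (u * (1 - u\<^sup>2)) * w"
      unfolding marked_crossing[OF M cr(1)] sg by (simp add: w_def)
    have "vsign D' b (c 1 + r 1 * u) (c 0 + r 0 * (4/5 * u)) =
        (if mark D' (c 1 + r 1 * u) = Virt b then sgn (r 1) * sgn (r 0) * sgn (- (24/5 * u * (1 - u\<^sup>2))) else 0)"
      by (rule D'.vsign_strands[OF len(2) bd(1) R2_bigon_velocity(2) len(1) bd(2) R2_bigon_velocity(1)]) simp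
    then show "vsign D' b (c 1 + r 1 * u) (c 0 + r 0 * (4/5 * u)) = - sgn (u * (1 - u\<^sup>2)) * w"
      unfolding marked_crossing[OF M cr(2)] sg by (simp add: w_def)
  qed
  have fl: "\<lfloor>x - (c 0 + r 0 * (4/5 * u))\<rfloor> = \<lfloor>x - c 0\<rfloor>" "\<lfloor>x - (c 1 + r 1 * u)\<rfloor> = \<lfloor>x - c 1\<rfloor>"
    if "x = s \<or> x = t" "u = kink_pos \<or> u = - kink_pos" for x u
  proof -
    have "off_strand c r 0 x" "off_strand c r 1 x" using that(1) off[of 0] off[of 1] by auto
    moreover have "4/5 * u \<in> {-1..1}" "u \<in> {-1..1}" using that(2) kink_pos_bounds by auto
    ultimately show "\<lfloor>x - (c 0 + r 0 * (4/5 * u))\<rfloor> = \<lfloor>x - c 0\<rfloor>" "\<lfloor>x - (c 1 + r 1 * u)\<rfloor> = \<lfloor>x - c 1\<rfloor>"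
      using floor_off_strand by blast+
  qed
  have X: "tangle_crossings R2_bigon =
    {((0, 4/5 * kink_pos), (1, kink_pos)), ((1, kink_pos), (0, 4/5 * kink_pos)),
     ((0, 4/5 * - kink_pos), (1, - kink_pos)), ((1, - kink_pos), (0, 4/5 * - kink_pos))}"
    by (simp add: tangle_crossings_R2_bigon)
  let ?g = "\<lambda>x y. vsign D' b (param c r x) (param c r y) * of_int (\<lfloor>t - param c r x\<rfloor> - \<lfloor>s - param c r x\<rfloor>)"
  have "inner_index R2_bigon c r D' b s t =
    ?g (0, 4/5 * kink_pos) (1, kink_pos) + ?g (1, kink_pos) (0, 4/5 * kink_pos)
    + ?g (0, 4/5 * - kink_pos) (1, - kink_pos) + ?g (1, - kink_pos) (0, 4/5 * - kink_pos)"
    unfolding inner_index_def X using kink_pos_bounds by simp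
  also have "\<dots> = 0"
    unfolding param_simp vs[OF disjI1[OF refl]] vs[OF disjI2[OF refl]]
      fl[OF disjI1[OF refl] disjI1[OF refl]] fl[OF disjI1[OF refl] disjI2[OF refl]]
      fl[OF disjI2[OF refl] disjI1[OF refl]] fl[OF disjI2[OF refl] disjI2[OF refl]]
    unfolding sgn_kink by (simp add: algebra_simps)
  finally show "inner_index R2_plain c r D b s t = inner_index R2_bigon c r D' b s t"
    by (simp add: inner_no_crossings[OF tangle_crossings_R2_plain])
qed

lemma parity_Omega3cv:
  assumes R: "replaces (R3_tangle 1) (R3_tangle (-1)) c r D D'" and k: "k \<in> {0, 1::nat}"
    and M: "marked (R3_tangle 1) c r (\<lambda>i u j v. if i = 2 \<or> j = 2 then Virt a else if i = k then Over else Under) D"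
      "marked (R3_tangle (-1)) c r (\<lambda>i u j v. if i = 2 \<or> j = 2 then Virt a else if i = k then Over else Under) D'"
  shows "even (card (indexed_crossings D f)) = even (card (indexed_crossings D' f))"
proof (rule parity_R3[OF R M])
  let ?M = "\<lambda>i j. if i = 2 \<or> j = 2 then Virt a else if i = k then Over else Under"
  fix i j b
  assume "(i, j) \<in> R3_strands" and over: "?M i j = Over"
    and D: "embedded_R3 1 c r D ?M" and D': "embedded_R3 (-1) c r D' ?M"
  have eq: "inner_index (R3_tangle 1) c r D b (c 0) (c 1) = inner_index (R3_tangle (-1)) c r D' b (c 0) (c 1)"
    by (rule inner_index_Omega3cv[OF D D']) auto
  \<comment> \<open>Crossings with strand 2 are virtual, so only the crossing of strands 0 and 1 is
    left. If strand 1 is the upper one, \<open>inner_index_swap\<close> exchanges the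
    endpoints.\<close>
  from \<open>(i, j) \<in> R3_strands\<close> over have "i = 0 \<and> j = 1 \<or> i = 1 \<and> j = 0"
    by (auto split: if_splits)
  then show "inner_index (R3_tangle 1) c r D b (c i + r i * R3_pos 1 i j) (c j + r j * R3_pos 1 j i) =
      inner_index (R3_tangle (-1)) c r D' b (c i + r i * R3_pos (-1) i j) (c j + r j * R3_pos (-1) j i)"
    using eq inner_index_swap[of _ c r D b "c 0" "c 1"] inner_index_swap[of _ c r D' b "c 0" "c 1"]
    by (auto simp: R3_pos_def)
qed

lemma parity_reidemeister_move:
  assumes "reidemeister_move D D'" "f a \<noteq> 0"
  shows "even (card (indexed_crossings D f)) = even (card (indexed_crossings D' f))"
  using assms(1)
proof cases
  case (Omega1 c r p q)
  then show ?thesis using parity_Omega1 assms(2) by blast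
next
  case (Omega1v c r b)
  then show ?thesis by (rule parity_Omega1v)
next
  case (Omega2 c r k)
  then show ?thesis by (rule parity_Omega2)
next
  case (Omega2v c r b)
  then show ?thesis by (rule parity_Omega2v)
next
  case (Omega3 c r height L)
  show ?thesis
  proof (rule parity_R3[OF Omega3(1) Omega3(4,5)[unfolded Omega3(3)]])
    let ?M = "\<lambda>i j. if height i > height j then Over else Under"
    fix i j b
    assume "embedded_R3 1 c r D ?M" "embedded_R3 (-1) c r D' ?M"
    \<comment> \<open>All crossings of the triangle are classical, so it contributes to no
      index.\<close>
    have "inner_index (R3_tangle 1) c r D b s t = 0" "inner_index (R3_tangle (-1)) c r D' b s t = 0" for s t
      by (rule inner_index_eq_0, use Omega3(3) marked_mark[OF Omega3(4)] marked_mark[OF Omega3(5)] in auto)+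
    then show "inner_index (R3_tangle 1) c r D b (c i + r i * R3_pos 1 i j) (c j + r j * R3_pos 1 j i) =
      inner_index (R3_tangle (-1)) c r D' b (c i + r i * R3_pos (-1) i j) (c j + r j * R3_pos (-1) j i)"
      by simp
  qed
next
  case (Omega3v c r L a b)
  \<comment> \<open>All marks are virtual here, so the condition on over-passages is
    vacuous.\<close>
  show ?thesis
    by (rule parity_R3[OF Omega3v(1) Omega3v(3,4)[unfolded Omega3v(2)]]) (simp split: if_splits)
next
  case (Omega3cv c r k L b)
  then show ?thesis using parity_Omega3cv by blast
qed

lemma parity_equivalent:
  assumes "equivalent D D'" "f a \<noteq> 0"
  shows "even (card (indexed_crossings D f)) = even (card (indexed_crossings D' f))"
  using assms(1) unfolding equivalent_def
proof (induction rule: equivclp_induct)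
  case (step y z)
  have one: "even (card (indexed_crossings x f)) = even (card (indexed_crossings x' f))"
    if "planar_isotopic x x' \<or> reidemeister_move x x'" for x x'
    using that card_indexed_crossings_isotopic[of x x' f] parity_reidemeister_move[of x x' f, OF _ assms(2)]
    by auto
  from step(2) one[of y z] one[of z y] step(3) show ?case by blast
qed simp

section \<open>Closed 2-braids\<close>

lemma curve_closed_2braid:
  "curve (closed_2braid w) t = of_real (2 + cos (2 * pi * real (length w) * t)) * cis (4 * pi * t)"
  by (simp add: closed_2braid_def Let_def)

lemma cos_int_shift: "cos (x + pi * of_int k) = (if even k then cos x else - cos x)"
  and sin_int_shift: "sin (x + pi * of_int k) = (if even k then sin x else - sin x)" for x :: real
  by (auto simp: cos_add sin_add)

lemma cis_int_shift: "cis (x + 2 * pi * of_int k) = cis x"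
  by (simp add: cis_mult[symmetric])

text \<open>The zeros of \<open>cos (2 * pi * m * t)\<close>. Adding \<open>m\<close> to
  \<open>j\<close> advances the parameter by 1/2, once around the origin; \<open>j\<close> is an
  integer so that such shifts go both ways.\<close>

definition braid_param :: "nat \<Rightarrow> int \<Rightarrow> real" where
  "braid_param m j = (2 * of_int j + 1) / (4 * real m)"

context
  fixes w :: "braid_letter list" and m :: nat
  assumes m: "m = length w" and odd_m: "odd m"
begin

private abbreviation "B \<equiv> closed_2braid w"

lemma braid_m_pos: "m > 0" using odd_m by (rule odd_pos)

lemma braid_param_shift: "odd k \<Longrightarrow> braid_param m (j + k * int m) = braid_param m j + of_int k / 2"
  using braid_m_pos by (simp add: braid_param_def field_simps)

lemma curve_braid_periodic: "curve B (t + 1) = curve B t"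
  using cos_int_shift[of "2 * pi * real m * t" "2 * int m"] cis_int_shift[of "4 * pi * t" 2]
  by (simp add: curve_closed_2braid m[symmetric] algebra_simps)

lemma mark_braid:
  "mark B t = (let j = \<lfloor>2 * real m * t\<rfloor> in case w ! nat (j mod int m) of
     Sigma1 \<Rightarrow> (if odd j then Over else Under) | VirtualLetter a \<Rightarrow> Virt a)"
  by (simp add: closed_2braid_def Let_def m)

lemma mark_braid_periodic: "mark B (t + 1) = mark B t"
proof -
  have "2 * real m * (t + 1) = 2 * real m * t + of_int (2 * int m)" by (simp add: algebra_simps)
  then have "\<lfloor>2 * real m * (t + 1)\<rfloor> = \<lfloor>2 * real m * t\<rfloor> + 2 * int m" by (simp only: floor_add_int[symmetric])
  then show ?thesis by (simp add: mark_braid Let_def)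
qed

lemma mark_braid_param:
  "mark B (braid_param m j) = (case w ! nat (j mod int m) of
     Sigma1 \<Rightarrow> (if odd j then Over else Under) | VirtualLetter a \<Rightarrow> Virt a)"
proof -
  have "2 * real m * braid_param m j = of_int j + 1/2"
    using braid_m_pos by (simp add: braid_param_def field_simps)
  then have "\<lfloor>2 * real m * braid_param m j\<rfloor> = j" by (simp add: floor_eq_iff)
  then show ?thesis by (simp add: mark_braid)
qed

text \<open>The distance from the origin is positive, so moduli and arguments can be compared. The
  arguments give \<open>t = s + k / 2\<close>, with \<open>k\<close> odd as \<open>s - t\<close> is
  no integer. Since \<open>m\<close> is odd, this shift negates the cosine, so equal moduli force it
  to be 0.\<close>

lemma braid_double_point:
  "s - t \<notin> \<int> \<and> curve B s = curve B t \<longleftrightarrow>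
     (\<exists>j k. odd k \<and> s = braid_param m j \<and> t = braid_param m (j + k * int m))"
proof
  assume st: "s - t \<notin> \<int> \<and> curve B s = curve B t"
  let ?R = "\<lambda>u. 2 + cos (2 * pi * real m * u)"
  have pos: "?R u > 0" for u using cos_ge_minus_one[of "2 * pi * real m * u"] by linarith
  have eq: "of_real (?R s) * cis (4 * pi * s) = (of_real (?R t) * cis (4 * pi * t) :: complex)"
    using st by (simp add: curve_closed_2braid m)
  then have "norm (of_real (?R s) * cis (4 * pi * s)) = norm (of_real (?R t) * cis (4 * pi * t) :: complex)"
    by (rule arg_cong)
  then have R: "?R s = ?R t" using pos[of s] pos[of t] by (simp add: norm_mult del: of_real_add)
  then have "cis (4 * pi * s) = cis (4 * pi * t)" using eq pos[of t] by (simp del: of_real_add)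
  then have "exp (\<i> * of_real (4 * pi * t)) = exp (\<i> * of_real (4 * pi * s))" by (simp only: cis_conv_exp)
  then obtain k :: int where "\<i> * of_real (4 * pi * t) = \<i> * of_real (4 * pi * s) + of_int (2 * k) * pi * \<i>"
    unfolding exp_eq by blast
  then have "Im (\<i> * of_real (4 * pi * t)) = Im (\<i> * of_real (4 * pi * s) + of_int (2 * k) * pi * \<i>)"
    by (rule arg_cong)
  then have "pi * (4 * t) = pi * (4 * s + 2 * of_int k)" by (simp add: algebra_simps)
  then have t: "t = s + of_int k / 2" by simp
  have k: "odd k"
  proof
    assume "even k"
    then obtain l where "k = 2 * l" by (elim evenE)
    then have "s - t = of_int (- l)" using t by simp
    then show False using st by (metis Ints_of_int)
  qed
  have "2 * pi * real m * t = 2 * pi * real m * s + pi * of_int (k * int m)" by (simp add: t algebra_simps)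
  then have "cos (2 * pi * real m * t) = - cos (2 * pi * real m * s)"
    using cos_int_shift[of "2 * pi * real m * s" "k * int m"] k odd_m by simp
  then have "cos (2 * pi * real m * s) = 0" using R by simp
  then obtain j :: int where "2 * pi * real m * s = j * pi + pi / 2"
    unfolding cos_zero_iff_int2 by blast
  then have "pi * (2 * real m * s) = pi * (of_int j + 1/2)" by (simp add: algebra_simps)
  then have "2 * real m * s = of_int j + 1/2" by simp
  then have s: "s = braid_param m j" using braid_m_pos by (simp add: braid_param_def field_simps)
  show "\<exists>j k. odd k \<and> s = braid_param m j \<and> t = braid_param m (j + k * int m)"
    by (rule exI[of _ j], rule exI[of _ k]) (simp add: s t k braid_param_shift)
next
  assume "\<exists>j k. odd k \<and> s = braid_param m j \<and> t = braid_param m (j + k * int m)"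
  then obtain j k where k: "odd k" and s: "s = braid_param m j" and "t = braid_param m (j + k * int m)"
    by blast
  then have t: "t = braid_param m j + of_int k / 2" using braid_param_shift[OF k] by simp
  have "s - t \<notin> \<int>"
  proof
    assume "s - t \<in> \<int>"
    then obtain l where "s - t = of_int l" by (auto elim: Ints_cases)
    then have "of_int k = (of_int (- 2 * l) :: real)" using s t by simp
    then have "k = - 2 * l" by (simp only: of_int_eq_iff)
    then show False using k by simp
  qed
  moreover have "curve B s = curve B t"
  proof -
    have half: "2 * pi * real m * s = pi / 2 + pi * of_int j"
      using braid_m_pos by (simp add: s braid_param_def field_simps)
    have "2 * pi * real m * t = 2 * pi * real m * s + pi * of_int (k * int m)"
      by (simp add: s t algebra_simps)
    then have "cos (2 * pi * real m * s) = 0" "cos (2 * pi * real m * t) = 0"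
      using cos_int_shift[of "2 * pi * real m * s" "k * int m"] cos_int_shift[of "pi / 2" j] half by simp_all
    moreover have "4 * pi * t = 4 * pi * s + 2 * pi * of_int k" by (simp add: s t algebra_simps)
    ultimately show ?thesis by (simp add: curve_closed_2braid m[symmetric] cis_int_shift)
  qed
  ultimately show "s - t \<notin> \<int> \<and> curve B s = curve B t" by simp
qed

text \<open>Written in the rotating frame, with radial velocity as real part and tangential velocity
  as imaginary part. Both passages through a crossing have the same frame, which cancels in the
  determinant.\<close>

lemma braid_has_velocity:
  "(curve B has_vector_derivative
     cis (4 * pi * t) * Complex (- 2 * pi * m * sin (2 * pi * m * t)) (4 * pi * (2 + cos (2 * pi * m * t)))) (at t)"
proof -
  have 1: "((\<lambda>t. complex_of_real (2 + cos (2 * pi * m * t))) has_vector_derivative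
      of_real (- 2 * pi * m * sin (2 * pi * m * t))) (at t)"
    by (intro has_vector_derivative_of_real) (auto intro!: derivative_eq_intros)
  have 2: "((\<lambda>t. cis (4 * pi * t)) has_vector_derivative of_real (4 * pi) * \<i> * cis (4 * pi * t)) (at t)"
    unfolding has_vector_derivative_def
    by (rule derivative_eq_intros refl | simp add: scaleR_conv_of_real fun_eq_iff)+
  have "curve B = (\<lambda>t. complex_of_real (2 + cos (2 * pi * m * t)) * cis (4 * pi * t))"
    by (simp add: fun_eq_iff curve_closed_2braid m)
  moreover have "of_real (2 + cos (2 * pi * m * t)) * (of_real (4 * pi) * \<i> * cis (4 * pi * t))
        + of_real (- 2 * pi * m * sin (2 * pi * m * t)) * cis (4 * pi * t) =
      cis (4 * pi * t) * Complex (- 2 * pi * m * sin (2 * pi * m * t)) (4 * pi * (2 + cos (2 * pi * m * t)))"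
    by (simp add: Complex_eq algebra_simps)
  ultimately show ?thesis
    using has_vector_derivative_mult[OF 1 2] by (simp only:)
qed

lemma braid_velocity:
  "velocity B t = cis (4 * pi * t) * Complex (- 2 * pi * m * sin (2 * pi * m * t)) (4 * pi * (2 + cos (2 * pi * m * t)))"
  by (rule velocity_unique[OF braid_has_velocity])

text \<open>Since \<open>k * m\<close> is odd, the two passages have opposite radial and equal
  tangential velocities.\<close>

lemma braid_crossing_det:
  assumes "odd k"
  shows "Im (cnj (velocity B (braid_param m j)) * velocity B (braid_param m (j + k * int m)))
    = (if even j then - 1 else 1) * (32 * pi\<^sup>2 * m)"
proof -
  have arg: "2 * pi * m * braid_param m i = pi / 2 + pi * of_int i" for i
    using braid_m_pos by (simp add: braid_param_def field_simps)
  have v: "velocity B (braid_param m i) = cis (4 * pi * braid_param m i) * Complex (- 2 * pi * m * (if even i then 1 else -1)) (8 * pi)" for i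
    unfolding braid_velocity arg cos_int_shift sin_int_shift by simp
  have "4 * pi * braid_param m (j + k * int m) = 4 * pi * braid_param m j + 2 * pi * of_int k"
    by (simp add: braid_param_shift[OF assms] algebra_simps)
  then have c: "cis (4 * pi * braid_param m (j + k * int m)) = cis (4 * pi * braid_param m j)"
    by (simp only: cis_int_shift)
  have cancel: "cnj (cis x * y) * (cis x * z) = cnj y * z" for x y z
  proof -
    have "cnj (cis x * y) * (cis x * z) = (cis (- x) * cis x) * (cnj y * z)" by (simp add: cis_cnj)
    then show ?thesis by (simp add: cis_mult)
  qed
  show ?thesis
    unfolding v c cancel using assms odd_m by (simp add: power2_eq_square algebra_simps)
qed

lemma crossing_pairs_braid:
  "crossing_pairs B =
     (\<lambda>j. (braid_param m (int j), braid_param m (int (j + m)))) ` {..<m} \<union>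
     (\<lambda>j. (braid_param m (int (j + m)), braid_param m (int j))) ` {..<m}" (is "_ = ?X \<union> ?Y")
proof (intro equalityI subsetI)
  fix p assume p: "p \<in> crossing_pairs B"
  obtain s t where st: "p = (s, t)" by (cases p)
  then have "s - t \<notin> \<int> \<and> curve B s = curve B t" and unit: "s \<in> {0..<1}" "t \<in> {0..<1}"
    using p by (simp_all add: crossing_pairs_iff)
  then obtain j k where k: "odd k" and s: "s = braid_param m j" and t: "t = braid_param m (j + k * int m)"
    unfolding braid_double_point by blast
  have range: "0 \<le> i \<and> i < 2 * int m" if "braid_param m i \<in> {0..<1}" for i
  proof -
    have "0 \<le> 2 * real_of_int i + 1" "2 * real_of_int i + 1 < 4 * real m"
      using that braid_m_pos by (auto simp: braid_param_def field_simps)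
    then have "0 \<le> 2 * i + 1" "2 * i + 1 < 4 * int m" by linarith+
    then show ?thesis by linarith
  qed
  have j: "0 \<le> j" "j < 2 * int m" "0 \<le> j + k * int m" "j + k * int m < 2 * int m"
    using range[of j] range[of "j + k * int m"] unit s t by auto
  have "\<bar>of_int k / 2 :: real\<bar> < 1" using braid_param_shift[OF k, of j] unit s t by auto
  then have "\<bar>k\<bar> < 2" by linarith
  then have "k = 1 \<or> k = - 1" using k by presburger
  then show "p \<in> ?X \<union> ?Y"
  proof
    assume "k = 1"
    then have "p = (braid_param m (int (nat j)), braid_param m (int (nat j + m)))" "nat j < m"
      using j by (auto simp: st s t)
    then show ?thesis by blast
  next
    assume "k = - 1"
    then have "p = (braid_param m (int (nat (j - m) + m)), braid_param m (int (nat (j - m))))" "nat (j - m) < m"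
      using j by (auto simp: st s t)
    then show ?thesis by blast
  qed
next
  fix p assume "p \<in> ?X \<union> ?Y"
  then obtain j where j: "j < m" and p: "p = (braid_param m (int j), braid_param m (int (j + m))) \<or>
      p = (braid_param m (int (j + m)), braid_param m (int j))" by blast
  have unit: "braid_param m (int j) \<in> {0..<1}" "braid_param m (int (j + m)) \<in> {0..<1}"
    using j by (auto simp: braid_param_def field_simps)
  have "\<exists>j' k. odd k \<and> braid_param m (int j) = braid_param m j' \<and>
      braid_param m (int (j + m)) = braid_param m (j' + k * int m)"
    by (rule exI[of _ "int j"], rule exI[of _ 1]) simp
  then have "(braid_param m (int j), braid_param m (int (j + m))) \<in> crossing_pairs B"
    using unit unfolding crossing_pairs_iff braid_double_point[symmetric] by blast
  then show "p \<in> crossing_pairs B" using p crossing_pairs_swap by blast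
qed

lemma is_diagram_braid: "is_diagram B"
proof -
  have "C1_immersion (curve B)"
    unfolding C1_immersion_def
  proof (intro conjI allI)
    show "curve B differentiable at t" for t
      using braid_has_velocity by (rule differentiableI_vector)
    show "velocity B t \<noteq> 0" for t
    proof -
      have "2 + cos (2 * pi * m * t) > 0" using cos_ge_minus_one[of "2 * pi * m * t"] by linarith
      then have "Complex (- 2 * pi * m * sin (2 * pi * m * t)) (4 * pi * (2 + cos (2 * pi * m * t))) \<noteq> 0"
        by (simp add: complex_eq_iff)
      then show ?thesis unfolding braid_velocity by simp
    qed
    show "continuous_on UNIV (velocity B)"
      unfolding braid_velocity Complex_eq by (intro continuous_intros)
  qed
  \<comment> \<open>\<open>double_points_eq\<close> presupposes a diagram, so the inclusion is
    derived from periodicity alone.\<close>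
  moreover have "finite (double_points B)"
  proof (rule finite_subset)
    show "double_points B \<subseteq> (\<lambda>(s, t). curve B s) ` crossing_pairs B"
    proof
      fix z assume "z \<in> double_points B"
      then obtain s t where st: "z = curve B s" "s - t \<notin> \<int>" "curve B s = curve B t"
        by (auto simp: double_points_def)
      have fr: "curve B (frac u) = curve B u" for u
        using curve_braid_periodic by (rule periodic_frac)
      have "(frac s, frac t) \<in> crossing_pairs B"
        using st frac_in_unit[of s] frac_in_unit[of t]
        by (simp add: crossing_pairs_def Ints_diff_iff_frac_eq fr)
      then show "z \<in> (\<lambda>(s, t). curve B s) ` crossing_pairs B"
        using fr[of s] st(1) by force
    qed
    show "finite ((\<lambda>(s, t). curve B s) ` crossing_pairs B)"
      unfolding crossing_pairs_braid by simp
  qed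
  moreover have "Im (cnj (velocity B s) * velocity B t) \<noteq> 0 \<and> compatible (mark B s) (mark B t)"
    if st: "s - t \<notin> \<int> \<and> curve B s = curve B t" for s t
  proof -
    obtain j k where k: "odd k" and s: "s = braid_param m j" and t: "t = braid_param m (j + k * int m)"
      using st unfolding braid_double_point by blast
    have "Im (cnj (velocity B s) * velocity B t) \<noteq> 0"
      unfolding s t braid_crossing_det[OF k] using braid_m_pos by simp
    \<comment> \<open>\<open>k * m\<close> is odd, so exactly one of the two indices is odd, and a
      \<open>Sigma1\<close> is passed once over and once under.\<close>
    moreover have "compatible (mark B s) (mark B t)"
      unfolding s t mark_braid_param using k odd_m by (simp split: braid_letter.split)
    ultimately show ?thesis by simp
  qed
  moreover have "r - s \<in> \<int> \<or> s - t \<in> \<int> \<or> r - t \<in> \<int>" if "curve B r = curve B s" "curve B s = curve B t" for r s t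
  proof (rule ccontr)
    assume "\<not> (r - s \<in> \<int> \<or> s - t \<in> \<int> \<or> r - t \<in> \<int>)"
    then have "r - s \<notin> \<int> \<and> curve B r = curve B s" "s - t \<notin> \<int> \<and> curve B s = curve B t" and rt: "r - t \<notin> \<int>"
      using that by auto
    then obtain k l :: int where kl: "odd k" "odd l" "s = r + of_int k / 2" "t = s + of_int l / 2"
      unfolding braid_double_point using braid_param_shift by metis
    \<comment> \<open>Two odd multiples of a half turn add up to whole turns, which excludes triple
      points.\<close>
    then obtain i where "k + l = 2 * i" by (metis odd_even_add evenE)
    then have "of_int k + of_int l = (2 * of_int i :: real)" by (metis of_int_add of_int_mult of_int_numeral)
    then have "r - t = of_int (- i)" using kl by (simp add: field_simps)
    then show False using rt by (metis Ints_of_int)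
  qed
  ultimately show ?thesis
    unfolding is_diagram_def using curve_braid_periodic mark_braid_periodic by blast
qed

lemma inj_braid_param: "braid_param m i = braid_param m j \<longleftrightarrow> i = j"
  using braid_m_pos by (simp add: braid_param_def field_simps)

lemma card_crossing_pairs_braid: "card (crossing_pairs B) = 2 * m"
proof -
  have "inj_on (\<lambda>j. (braid_param m (int j), braid_param m (int (j + m)))) {..<m}"
    "inj_on (\<lambda>j. (braid_param m (int (j + m)), braid_param m (int j))) {..<m}"
    by (auto intro!: inj_onI simp: inj_braid_param)
  then show ?thesis
    unfolding crossing_pairs_braid
    by (subst card_Un_disjoint) (auto simp: card_image inj_braid_param)
qed

lemma card_double_points_braid: "card (double_points B) = m"
  using card_crossing_pairs[OF is_diagram_braid] card_crossing_pairs_braid by simp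

lemma floor_braid_param_diff:
  assumes "i < 2 * m" "j < 2 * m"
  shows "\<lfloor>braid_param m (int i) - braid_param m (int j)\<rfloor> = (if j \<le> i then 0 else - 1)"
proof -
  have "braid_param m (int i) - braid_param m (int j) = (real i - real j) / (2 * m)"
    using braid_m_pos by (simp add: braid_param_def field_simps)
  then show ?thesis using assms by (simp only:) (auto simp: floor_eq_iff field_simps)
qed

text \<open>As \<open>m = l + 1\<close>, the indices above \<open>l\<close> and up to
  \<open>l + m\<close> are exactly the second passages \<open>j + m\<close> of all letters. Going
  backwards from \<open>l + m\<close> to \<open>l\<close> counts each of them with weight -1, and
  the determinant there has the sign \<open>(- 1) ^ j\<close>.\<close>

lemma vindex_braid:
  assumes "m = Suc l"
  shows "vindex B a (braid_param m (int (l + m))) (braid_param m (int l)) =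
    - (\<Sum>j<m. if w ! j = VirtualLetter a then (- 1) ^ j else 0)"
proof -
  let ?p = "\<lambda>j. braid_param m (int j)"
  let ?G = "\<lambda>j. of_int (\<lfloor>?p l - ?p j\<rfloor> - \<lfloor>?p (l + m) - ?p j\<rfloor>) :: real"
  let ?h = "\<lambda>(r, r'). vsign B a r r' * of_int (\<lfloor>?p l - r\<rfloor> - \<lfloor>?p (l + m) - r\<rfloor>)"
  have inj: "inj_on (\<lambda>j. (?p j, ?p (j + m))) {..<m}" "inj_on (\<lambda>j. (?p (j + m), ?p j)) {..<m}"
    by (auto intro!: inj_onI simp: inj_braid_param)
  have G: "?G j = 0" "?G (j + m) = - 1" if "j < m" for j
    using that assms floor_braid_param_diff[of l j] floor_braid_param_diff[of "l + m" j]
      floor_braid_param_diff[of l "j + m"] floor_braid_param_diff[of "l + m" "j + m"] by auto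
  have vs: "vsign B a (?p (j + m)) (?p j) = (if w ! j = VirtualLetter a then (- 1) ^ j else 0)" if "j < m" for j
  proof -
    have "mark B (?p (j + m)) = Virt a \<longleftrightarrow> w ! j = VirtualLetter a"
      using that unfolding mark_braid_param by (simp add: nat_mod_distrib split: braid_letter.split)
    moreover have "Im (cnj (velocity B (?p (j + m))) * velocity B (?p j)) = (- 1) ^ j * (32 * pi\<^sup>2 * m)"
      using braid_crossing_det[of "- 1" "int (j + m)"] odd_m by simp
    moreover have "sgn ((- 1) ^ j * (32 * pi\<^sup>2 * m)) = (- 1 :: real) ^ j"
      using braid_m_pos by (cases "even j") (simp_all add: sgn_mult)
    ultimately show ?thesis by (simp only: vsign_def)
  qed
  have "vindex B a (?p (l + m)) (?p l) =
    sum ?h ((\<lambda>j. (?p j, ?p (j + m))) ` {..<m}) + sum ?h ((\<lambda>j. (?p (j + m), ?p j)) ` {..<m})"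
    unfolding vindex_def crossing_pairs_braid
    by (rule sum.union_disjoint) (auto simp: inj_braid_param)
  also have "\<dots> = (\<Sum>j<m. vsign B a (?p j) (?p (j + m)) * ?G j) + (\<Sum>j<m. vsign B a (?p (j + m)) (?p j) * ?G (j + m))"
    by (simp only: sum.reindex[OF inj(1)] sum.reindex[OF inj(2)] o_def case_prod_conv)
  also have "\<dots> = (\<Sum>j<m. 0) + (\<Sum>j<m. - (if w ! j = VirtualLetter a then (- 1) ^ j else 0))"
    by (intro arg_cong2[of _ _ _ _ "(+)"] sum.cong) (simp_all only: G vs lessThan_iff mult_zero_right mult_minus_right mult_1_right)
  finally show ?thesis by (simp add: sum_negf)
qed

text \<open>Over-passages have odd indices. As \<open>l\<close> is even and \<open>m\<close> is odd,
  the last letter is passed over at \<open>l + m\<close> and under at \<open>l\<close>.\<close>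

lemma indexed_crossings_braid:
  assumes l: "m = Suc l" and w: "\<And>j. j < m \<Longrightarrow> w ! j = Sigma1 \<longleftrightarrow> j = l"
    and f: "\<And>a. f a = vindex B a (braid_param m (int (l + m))) (braid_param m (int l))"
  shows "indexed_crossings B f = {(braid_param m (int (l + m)), braid_param m (int l))}"
proof -
  have over: "mark B (braid_param m (int i)) = Over \<longleftrightarrow> w ! (i mod m) = Sigma1 \<and> odd i" for i
    unfolding mark_braid_param by (simp add: nat_mod_distrib split: braid_letter.split)
  have even: "even l" using odd_m l by simp
  show ?thesis
  proof (intro equalityI subsetI)
    fix p assume p: "p \<in> indexed_crossings B f"
    then have "p \<in> crossing_pairs B" "mark B (fst p) = Over" by (auto simp: indexed_crossings_def)
    then obtain j where j: "j < m" and
      "p = (braid_param m (int j), braid_param m (int (j + m))) \<or>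
       p = (braid_param m (int (j + m)), braid_param m (int j))" (is "?P \<or> ?Q")
      unfolding crossing_pairs_braid by blast
    then show "p \<in> {(braid_param m (int (l + m)), braid_param m (int l))}"
    proof (elim disjE)
      assume ?P
      then have "w ! j = Sigma1" "odd j" using \<open>mark B (fst p) = Over\<close> over[of j] j by simp_all
      then show ?thesis using w[OF j] even by simp
    next
      assume ?Q
      then have "w ! j = Sigma1" using \<open>mark B (fst p) = Over\<close> over[of "j + m"] j by simp
      then show ?thesis using w[OF j] \<open>?Q\<close> by simp
    qed
  next
    fix p assume "p \<in> {(braid_param m (int (l + m)), braid_param m (int l))}"
    then have p: "p = (braid_param m (int (l + m)), braid_param m (int l))" by simp
    have "p \<in> crossing_pairs B" unfolding crossing_pairs_braid p using l by blast
    moreover have "(l + m) mod m = l" unfolding mod_add_self2 using l by simp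
    then have "mark B (braid_param m (int (l + m))) = Over"
      unfolding over using w[of l] l even by simp
    ultimately show "p \<in> indexed_crossings B f" using f by (simp add: indexed_crossings_def p)
  qed
qed

end

section \<open>The total crossing number of K(n)\<close>

abbreviation alternating_word :: "nat \<Rightarrow> braid_letter list" where
  "alternating_word n \<equiv> concat (replicate n [VirtualLetter Alpha1, VirtualLetter Alpha2]) @ [Sigma1]"

lemma length_alternating_word: "length (alternating_word n) = 2 * n + 1"
  by (induction n) auto

lemma nth_alternating_word:
  "j \<le> 2 * n \<Longrightarrow> alternating_word n ! j =
     (if j = 2 * n then Sigma1 else VirtualLetter (if even j then Alpha1 else Alpha2))"
proof (induction n arbitrary: j)
  case (Suc n)
  consider "j = 0" | "j = 1" | i where "j = Suc (Suc i)" by (metis One_nat_def not0_implies_Suc)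
  then show ?case
  proof cases
    case 3
    then show ?thesis using Suc.IH[of i] Suc.prems by simp
  qed simp_all
qed simp

text \<open>The types alternate in step with \<open>(- 1) ^ j\<close>: \<open>Alpha1\<close> sits at
  the even positions and \<open>Alpha2\<close> at the odd ones, so there is no cancellation.\<close>

lemma sum_alternating_word:
  "(\<Sum>j<2 * n + 1. if alternating_word n ! j = VirtualLetter a then (- 1) ^ j else 0) =
     (if a = Alpha1 then real n else - real n)"
proof -
  have "(\<Sum>j<2 * n + 1. if alternating_word n ! j = VirtualLetter a then (- 1) ^ j else (0::real)) =
      (\<Sum>j<2 * n. if (if even j then Alpha1 else Alpha2) = a then (- 1) ^ j else 0)"
    by (simp add: nth_alternating_word)
  also have "\<dots> = (if a = Alpha1 then real n else - real n)"
    by (induction n; cases a) auto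
  finally show ?thesis .
qed

theorem mainTheorem2:
  fixes n :: nat
  assumes "n \<ge> 1"
  shows "total_crossing_number (K n) = 2 * n + 1"
proof -
  let ?w = "alternating_word n" and ?m = "2 * n + 1"
  let ?B = "closed_2braid ?w"
  have m: "?m = length ?w" "odd ?m" by (simp_all only: length_alternating_word) simp
  note diagram = is_diagram_braid[OF m] and card_B = card_double_points_braid[OF m]
  define f where "f a = vindex ?B a (braid_param ?m (int (2 * n + ?m))) (braid_param ?m (int (2 * n)))" for a
  have f: "f a = (if a = Alpha1 then - real n else real n)" for a
    unfolding f_def vindex_braid[OF m Suc_eq_plus1[symmetric]] sum_alternating_word by simp
  have "indexed_crossings ?B f = {(braid_param ?m (int (2 * n + ?m)), braid_param ?m (int (2 * n)))}"
    by (rule indexed_crossings_braid[OF m Suc_eq_plus1[symmetric] _ f_def])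
      (simp add: nth_alternating_word split: if_splits)
  then have odd: "odd (card (indexed_crossings ?B f))" by simp
  \<comment> \<open>Here \<open>n \<ge> 1\<close> enters: the parity argument requires a nonzero
    index.\<close>
  have "f Alpha1 \<noteq> 0" using assms by (simp add: f)
  have lower: "?m \<le> card (double_points D)" if "D \<in> K n" for D
  proof -
    have D: "is_diagram D" "equivalent ?B D" using that by (auto simp: K_def mv_knot_def)
    have "odd (card (indexed_crossings D f))"
      using parity_equivalent[OF D(2), of f Alpha1] \<open>f Alpha1 \<noteq> 0\<close> odd by simp
    then have "indexed_crossings D f \<noteq> {}" by auto
    then have "1 + \<bar>f Alpha1\<bar> + \<bar>f Alpha2\<bar> \<le> card (double_points D)"
      by (rule crossing_number_bound[OF D(1)])
    then show ?thesis by (simp add: f)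
  qed
  have "?B \<in> K n"
    using diagram by (simp add: K_def mv_knot_def equivalent_def)
  then show ?thesis
    unfolding total_crossing_number_def using card_B lower by (intro Least_equality) auto
qed

end
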